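(* Let $R$ be an Artinian ring and $M$ an $R$-module. Assume that $M$ is not a vertex of $AG(M)$ and that $Ann(M)$ is a nil ideal. Then $AG(M)$ is a star graph if and only if either $M=M_1\oplus M_2$, where $M_1$ and $M_2$ are simple modules, or $R$ is a local ring with maximal ideal $p=(0:m)\in Ass(M)$ for some $0\neq m\in M$ and one of the following cases holds: (a) $p^2M=(0)$ and $pM=mR$ is the only nonzero proper submodule of $M$; (b) $p^3M=(0)$, $p^2M=mR$ is the only minimal submodule of $M$, and for every two distinct nonzero proper submodules $N_1,N_2$ of $M$ such that $N_i\neq mR$ ($i=1,2$), we have $N_1N_2=mR$; (c) $p^4M=(0)$, $p^3M\neq(0)$, $p^3M=mR$, and $\Lambda(M)^*=\{N<M \mid (N:M)=(pM:M)\}\cup\{p^2M,\,p^3M\}$.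
   Context: $R$ is a commutative ring with nonzero identity and $M$ is a unital $R$-module. $N\le M$ (resp. $N<M$) means that $N$ is a submodule (resp. proper submodule) of $M$. $\Lambda(M)^*$ is the set of nonzero proper submodules of $M$. For $N\le M$, $(N:M)=\{r\in R\mid rM\subseteq N\}$, and $Ann(M)=((0):M)$. For $m\in M$, $(0:m)=\{r\in R\mid rm=0\}$ and $mR=Rm$ is the cyclic submodule generated by $m$. $Ass(M)$ is the set of prime ideals of $R$ of the form $(0:m)$ with $0\neq m\in M$. An ideal is nil if all its elements are nilpotent. The product of $N,K\le M$ is $NK=(N:M)(K:M)M$. The annihilating-submodule graph $AG(M)$ is the undirected graph whose vertices are the nonzero submodules $N$ of $M$ (possibly $N=M$) for which there exists a nonzero proper submodule $K$ of $M$ (possibly $K=N$) with $NK=(0)$; two distinct vertices $N,K$ are adjacent if and only if $NK=(0)$. A star graph is a complete bipartite graph $K_{1,m}$ (a one-vertex graph counts as a star graph). *)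

theory Defs
  imports "HOL-Algebra.Algebra" "Graph_Theory.Pair_Digraph"
begin

section \<open>Rings\<close>

locale artinian_ring = ring +
  assumes descending_chain: "\<lbrakk>\<And>n :: nat. ideal (I n) R; \<And>n. I (Suc n) \<subseteq> I n\<rbrakk>
    \<Longrightarrow> \<exists>k. \<forall>n \<ge> k. I n = I k"

definition local_ring_with :: "('a, 'c) ring_scheme \<Rightarrow> 'a set \<Rightarrow> bool" where
  "local_ring_with R p \<longleftrightarrow> cring R \<and> maximalideal p R \<and> (\<forall>q. maximalideal q R \<longrightarrow> q = p)"

definition nil_ideal :: "'a set \<Rightarrow> ('a, 'c) ring_scheme \<Rightarrow> bool" where
  "nil_ideal I R \<longleftrightarrow> ideal I R \<and> (\<forall>x \<in> I. \<exists>n :: nat. x [^]\<^bsub>R\<^esub> n = \<zero>\<^bsub>R\<^esub>)"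

text \<open>The powers of an ideal in the multiplicative monoid of ideals of the ring, with unit the
  whole ring.\<close>

abbreviation ideal_power :: "('a, 'c) ring_scheme \<Rightarrow> 'a set \<Rightarrow> nat \<Rightarrow> 'a set" where
  "ideal_power R I n \<equiv> I [^]\<^bsub>ideals_set R\<^esub> n"


section \<open>Modules\<close>

definition proper_submodule :: "'b set \<Rightarrow> ('a, 'c) ring_scheme \<Rightarrow> ('a, 'b, 'd) module_scheme \<Rightarrow> bool"
  where "proper_submodule N R M \<longleftrightarrow> submodule N R M \<and> N \<noteq> carrier M"

definition nonzero_proper_submodules ::
    "('a, 'c) ring_scheme \<Rightarrow> ('a, 'b, 'd) module_scheme \<Rightarrow> 'b set set" where
  "nonzero_proper_submodules R M = {N. proper_submodule N R M \<and> N \<noteq> {\<zero>\<^bsub>M\<^esub>}}"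

definition minimal_submodule ::
    "'b set \<Rightarrow> ('a, 'c) ring_scheme \<Rightarrow> ('a, 'b, 'd) module_scheme \<Rightarrow> bool" where
  "minimal_submodule N R M \<longleftrightarrow> submodule N R M \<and> N \<noteq> {\<zero>\<^bsub>M\<^esub>} \<and>
     (\<forall>K. submodule K R M \<and> K \<noteq> {\<zero>\<^bsub>M\<^esub>} \<and> K \<subseteq> N \<longrightarrow> K = N)"

definition simple_module :: "('a, 'c) ring_scheme \<Rightarrow> ('a, 'b, 'd) module_scheme \<Rightarrow> bool" where
  "simple_module R M \<longleftrightarrow> module R M \<and> carrier M \<noteq> {\<zero>\<^bsub>M\<^esub>} \<and>
     (\<forall>K. submodule K R M \<longrightarrow> K = {\<zero>\<^bsub>M\<^esub>} \<or> K = carrier M)"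

text \<open>Internal direct sum of two submodules.\<close>

definition direct_sum ::
    "('a, 'c) ring_scheme \<Rightarrow> ('a, 'b, 'd) module_scheme \<Rightarrow> 'b set \<Rightarrow> 'b set \<Rightarrow> bool" where
  "direct_sum R M M1 M2 \<longleftrightarrow> submodule M1 R M \<and> submodule M2 R M \<and>
     M1 <+>\<^bsub>M\<^esub> M2 = carrier M \<and> M1 \<inter> M2 = {\<zero>\<^bsub>M\<^esub>}"

text \<open>The ideal \<open>(N : M)\<close>.\<close>

definition residual ::
    "('a, 'c) ring_scheme \<Rightarrow> ('a, 'b, 'd) module_scheme \<Rightarrow> 'b set \<Rightarrow> 'a set" where
  "residual R M N = {r \<in> carrier R. \<forall>x \<in> carrier M. r \<odot>\<^bsub>M\<^esub> x \<in> N}"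

definition annihilator :: "('a, 'c) ring_scheme \<Rightarrow> ('a, 'b, 'd) module_scheme \<Rightarrow> 'a set" where
  "annihilator R M = residual R M {\<zero>\<^bsub>M\<^esub>}"

text \<open>The ideal \<open>(0 : m)\<close>.\<close>

definition elem_annihilator ::
    "('a, 'c) ring_scheme \<Rightarrow> ('a, 'b, 'd) module_scheme \<Rightarrow> 'b \<Rightarrow> 'a set" where
  "elem_annihilator R M m = {r \<in> carrier R. r \<odot>\<^bsub>M\<^esub> m = \<zero>\<^bsub>M\<^esub>}"

definition cyclic_submodule ::
    "('a, 'c) ring_scheme \<Rightarrow> ('a, 'b, 'd) module_scheme \<Rightarrow> 'b \<Rightarrow> 'b set" where
  "cyclic_submodule R M m = (\<lambda>r. r \<odot>\<^bsub>M\<^esub> m) ` carrier R"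

definition associated_primes ::
    "('a, 'c) ring_scheme \<Rightarrow> ('a, 'b, 'd) module_scheme \<Rightarrow> 'a set set" where
  "associated_primes R M = {p. primeideal p R \<and>
     (\<exists>m \<in> carrier M. m \<noteq> \<zero>\<^bsub>M\<^esub> \<and> p = elem_annihilator R M m)}"

text \<open>The submodule \<open>I N\<close> of finite sums of elements \<open>a x\<close> with \<open>a \<in> I\<close>, \<open>x \<in> N\<close>, for an ideal
  \<open>I\<close> and a submodule \<open>N\<close>; the analogue of \<^const>\<open>ideal_prod\<close>.\<close>

inductive_set ideal_smult ::
    "('a, 'c) ring_scheme \<Rightarrow> ('a, 'b, 'd) module_scheme \<Rightarrow> 'a set \<Rightarrow> 'b set \<Rightarrow> 'b set"
  for R and M and I and N where
    smult: "\<lbrakk>a \<in> I; x \<in> N\<rbrakk> \<Longrightarrow> a \<odot>\<^bsub>M\<^esub> x \<in> ideal_smult R M I N"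
  | sum: "\<lbrakk>s \<in> ideal_smult R M I N; t \<in> ideal_smult R M I N\<rbrakk>
      \<Longrightarrow> s \<oplus>\<^bsub>M\<^esub> t \<in> ideal_smult R M I N"

definition submodule_prod ::
    "('a, 'c) ring_scheme \<Rightarrow> ('a, 'b, 'd) module_scheme \<Rightarrow> 'b set \<Rightarrow> 'b set \<Rightarrow> 'b set" where
  "submodule_prod R M N K =
     ideal_smult R M (ideal_prod R (residual R M N) (residual R M K)) (carrier M)"


section \<open>The annihilating-submodule graph\<close>

text \<open>An undirected simple graph is represented by the symmetric, irreflexive set of ordered
  pairs of adjacent vertices.\<close>

definition AG ::
    "('a, 'c) ring_scheme \<Rightarrow> ('a, 'b, 'd) module_scheme \<Rightarrow> 'b set pair_pre_digraph" where
  "AG R M = (let V = {N. submodule N R M \<and> N \<noteq> {\<zero>\<^bsub>M\<^esub>} \<and>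
         (\<exists>K \<in> nonzero_proper_submodules R M. submodule_prod R M N K = {\<zero>\<^bsub>M\<^esub>})}
     in \<lparr>pverts = V,
         parcs = {(N, K). N \<in> V \<and> K \<in> V \<and> N \<noteq> K \<and> submodule_prod R M N K = {\<zero>\<^bsub>M\<^esub>}}\<rparr>)"

text \<open>The part \<open>V\<close> may be empty (a one-vertex graph is a star) and may be infinite. The latter
  is why the library's \<open>complete_bipartite_digraph\<close>, restricted to finite graphs, is not used.
  The graph without vertices is not a star.\<close>

definition star_graph :: "'v pair_pre_digraph \<Rightarrow> bool" where
  "star_graph G \<longleftrightarrow> (\<exists>U V. pverts G = U \<union> V \<and> U \<inter> V = {} \<and> card U = 1 \<and>
     parcs G = U \<times> V \<union> V \<times> U)"

end

theory Submission
  imports Defs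
begin

text \<open>Descending chains of principal ideals put a simple submodule \<open>S = Rm\<close> into every nonzero
  submodule, and \<open>(0 : m)\<close> is maximal. If \<open>R\<close> is not local, it has a nontrivial idempotent \<open>e\<close>;
  neither \<open>e\<close> nor \<open>1 - e\<close> kills \<open>M\<close> since \<open>Ann(M)\<close> is nil. For a simple \<open>S \<subseteq> eM\<close> with
  \<open>q = (0 : S)\<close>, the edges \<open>(1-e)M - eM\<close>, \<open>(1-e)M - S\<close>, \<open>S - qM\<close> of a star must share a vertex,
  which forces \<open>S = eM\<close> (if \<open>qM = (1-e)M\<close>, then \<open>q\<close> kills \<open>eM\<close>, and \<open>S = eM\<close> follows from
  \<open>(S : M) M \<noteq> 0\<close>); by symmetry \<open>(1-e)M\<close> is simple as well.

  If \<open>R\<close> is local, \<open>S\<close> is adjacent to every other vertex, so being a star means that no edge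
  avoids \<open>S\<close>. The cases (a), (b), (c) are \<open>pM = S\<close>, \<open>p\<^sup>2M = S \<noteq> pM\<close>, and the rest. In the last
  case \<open>{x. p\<^sup>2x = 0} = p\<^sup>2M\<close>, so \<open>p\<^sup>4M = 0\<close>, and any \<open>a \<in> p\<close> with \<open>a p\<^sup>2M \<noteq> 0\<close> satisfies
  \<open>a\<^sup>2M = p\<^sup>2M\<close> and has kernel \<open>S\<close> on \<open>M\<close>, whence \<open>pM \<subseteq> aM\<close>. A vertex \<open>N \<noteq> S, p\<^sup>2M\<close> is not
  adjacent to \<open>p\<^sup>2M\<close>, so \<open>(N : M)\<close> contains such an \<open>a\<close> and \<open>N\<close> contains \<open>pM\<close>.\<close>

section \<open>Submodules and their products\<close>

context module
begin

section \<open>Scalar multiplication and closure properties of submodules\<close>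

lemma smult_lcomm:
  "\<lbrakk>a \<in> carrier R; b \<in> carrier R; x \<in> carrier M\<rbrakk> \<Longrightarrow> a \<odot>\<^bsub>M\<^esub> (b \<odot>\<^bsub>M\<^esub> x) = b \<odot>\<^bsub>M\<^esub> (a \<odot>\<^bsub>M\<^esub> x)"
  by (simp add: smult_assoc1[symmetric] R.m_comm)

lemma smult_rotate:
  assumes "a \<in> carrier R" "b \<in> carrier R" "c \<in> carrier R" "x \<in> carrier M"
  shows "a \<odot>\<^bsub>M\<^esub> (b \<odot>\<^bsub>M\<^esub> (c \<odot>\<^bsub>M\<^esub> x)) = c \<odot>\<^bsub>M\<^esub> (a \<odot>\<^bsub>M\<^esub> (b \<odot>\<^bsub>M\<^esub> x))"
  using smult_lcomm[OF assms(2-4)] smult_lcomm[OF assms(1,3) smult_closed[OF assms(2,4)]] by simp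

lemma submodule_carrier: "\<lbrakk>submodule N R M; x \<in> N\<rbrakk> \<Longrightarrow> x \<in> carrier M"
  using submoduleE(1) by blast

lemma submodule_smult: "\<lbrakk>submodule N R M; a \<in> carrier R; x \<in> N\<rbrakk> \<Longrightarrow> a \<odot>\<^bsub>M\<^esub> x \<in> N"
  using submoduleE(4) by blast

lemma submodule_add: "\<lbrakk>submodule N R M; x \<in> N; y \<in> N\<rbrakk> \<Longrightarrow> x \<oplus>\<^bsub>M\<^esub> y \<in> N"
  using submoduleE(5) by blast

lemma submodule_zero: "submodule N R M \<Longrightarrow> \<zero>\<^bsub>M\<^esub> \<in> N"
  by (metis submodule.axioms(1) subgroup.one_closed monoid.simps(2))

lemma submodule_diff: "\<lbrakk>submodule N R M; x \<in> N; y \<in> N\<rbrakk> \<Longrightarrow> x \<ominus>\<^bsub>M\<^esub> y \<in> N"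
  by (simp add: M.minus_eq submodule_add submoduleE(3))

lemma submodule_diff_cancel:
  assumes "submodule N R M" "x \<in> carrier M" "y \<in> N" "x \<ominus>\<^bsub>M\<^esub> y \<in> N"
  shows "x \<in> N"
proof -
  have "y \<in> carrier M" using assms submodule_carrier by blast
  then have "x = (x \<ominus>\<^bsub>M\<^esub> y) \<oplus>\<^bsub>M\<^esub> y"
    using assms(2) by (simp add: M.minus_eq M.a_assoc M.l_neg)
  then show ?thesis using submodule_add[OF assms(1,4,3)] by simp
qed

lemma smult_diff:
  "\<lbrakk>a \<in> carrier R; x \<in> carrier M; y \<in> carrier M\<rbrakk> \<Longrightarrow>
    a \<odot>\<^bsub>M\<^esub> (x \<ominus>\<^bsub>M\<^esub> y) = a \<odot>\<^bsub>M\<^esub> x \<ominus>\<^bsub>M\<^esub> a \<odot>\<^bsub>M\<^esub> y"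
  by (simp add: M.minus_eq smult_r_distr smult_r_minus)

lemma zero_submodule: "submodule {\<zero>\<^bsub>M\<^esub>} R M"
  by (rule submoduleI) auto

text \<open>Because the preimage of a submodule under a scalar is a submodule, a claim that ay lies
  in N for all y in a generated submodule has to be checked on generators only, by
  \<open>ideal_smult_least\<close>.\<close>

lemma preimage_submodule:
  assumes "a \<in> carrier R" "submodule N R M"
  shows "submodule {x \<in> carrier M. a \<odot>\<^bsub>M\<^esub> x \<in> N} R M"
proof (rule submoduleI)
  show "\<And>r x. r \<in> carrier R \<Longrightarrow> x \<in> {x \<in> carrier M. a \<odot>\<^bsub>M\<^esub> x \<in> N} \<Longrightarrow>
      r \<odot>\<^bsub>M\<^esub> x \<in> {x \<in> carrier M. a \<odot>\<^bsub>M\<^esub> x \<in> N}"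
    using assms by (auto simp: smult_lcomm[of a] submodule_smult)
qed (use assms in \<open>auto simp: submodule_zero smult_r_minus smult_r_distr submodule_add submoduleE(3)\<close>)

lemma kernel_submodule: "a \<in> carrier R \<Longrightarrow> submodule {x \<in> carrier M. a \<odot>\<^bsub>M\<^esub> x = \<zero>\<^bsub>M\<^esub>} R M"
  using preimage_submodule[OF _ zero_submodule] by simp

lemma image_submodule:
  assumes "a \<in> carrier R" "submodule N R M"
  shows "submodule ((\<lambda>x. a \<odot>\<^bsub>M\<^esub> x) ` N) R M"
proof (rule submoduleI)
  show "(\<lambda>x. a \<odot>\<^bsub>M\<^esub> x) ` N \<subseteq> carrier M" using assms submodule_carrier by auto
  show "\<zero>\<^bsub>M\<^esub> \<in> (\<lambda>x. a \<odot>\<^bsub>M\<^esub> x) ` N"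
    using assms submodule_zero by (metis image_eqI smult_r_null)
next
  fix y assume "y \<in> (\<lambda>x. a \<odot>\<^bsub>M\<^esub> x) ` N"
  then obtain x where x: "x \<in> N" "y = a \<odot>\<^bsub>M\<^esub> x" by blast
  then show "\<ominus>\<^bsub>M\<^esub> y \<in> (\<lambda>x. a \<odot>\<^bsub>M\<^esub> x) ` N"
    using assms submoduleE(3)[OF assms(2)] submodule_carrier[OF assms(2)]
    by (metis image_eqI smult_r_minus)
next
  fix y z assume "y \<in> (\<lambda>x. a \<odot>\<^bsub>M\<^esub> x) ` N" "z \<in> (\<lambda>x. a \<odot>\<^bsub>M\<^esub> x) ` N"
  then obtain u v where "u \<in> N" "y = a \<odot>\<^bsub>M\<^esub> u" "v \<in> N" "z = a \<odot>\<^bsub>M\<^esub> v" by blast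
  then show "y \<oplus>\<^bsub>M\<^esub> z \<in> (\<lambda>x. a \<odot>\<^bsub>M\<^esub> x) ` N"
    using assms submodule_add[OF assms(2)] submodule_carrier[OF assms(2)]
    by (metis image_eqI smult_r_distr)
next
  fix r y assume r: "r \<in> carrier R" and "y \<in> (\<lambda>x. a \<odot>\<^bsub>M\<^esub> x) ` N"
  then obtain x where x: "x \<in> N" "y = a \<odot>\<^bsub>M\<^esub> x" by blast
  then show "r \<odot>\<^bsub>M\<^esub> y \<in> (\<lambda>x. a \<odot>\<^bsub>M\<^esub> x) ` N"
    using assms r submodule_smult[OF assms(2)] submodule_carrier[OF assms(2)]
    by (metis image_eqI smult_lcomm)
qed

lemma cyclic_is_submodule:
  assumes m: "m \<in> carrier M"
  shows "submodule (cyclic_submodule R M m) R M"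
  unfolding cyclic_submodule_def
proof (rule submoduleI)
  show "(\<lambda>r. r \<odot>\<^bsub>M\<^esub> m) ` carrier R \<subseteq> carrier M" using m by auto
  show "\<zero>\<^bsub>M\<^esub> \<in> (\<lambda>r. r \<odot>\<^bsub>M\<^esub> m) ` carrier R"
    using m by (metis R.zero_closed image_eqI smult_l_null)
  show "\<And>a. a \<in> (\<lambda>r. r \<odot>\<^bsub>M\<^esub> m) ` carrier R \<Longrightarrow> \<ominus>\<^bsub>M\<^esub> a \<in> (\<lambda>r. r \<odot>\<^bsub>M\<^esub> m) ` carrier R"
    using m by (auto simp: smult_l_minus[symmetric])
  show "\<And>a b. \<lbrakk>a \<in> (\<lambda>r. r \<odot>\<^bsub>M\<^esub> m) ` carrier R; b \<in> (\<lambda>r. r \<odot>\<^bsub>M\<^esub> m) ` carrier R\<rbrakk>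
      \<Longrightarrow> a \<oplus>\<^bsub>M\<^esub> b \<in> (\<lambda>r. r \<odot>\<^bsub>M\<^esub> m) ` carrier R"
    using m by (auto simp: smult_l_distr[symmetric])
  show "\<And>a x. \<lbrakk>a \<in> carrier R; x \<in> (\<lambda>r. r \<odot>\<^bsub>M\<^esub> m) ` carrier R\<rbrakk>
      \<Longrightarrow> a \<odot>\<^bsub>M\<^esub> x \<in> (\<lambda>r. r \<odot>\<^bsub>M\<^esub> m) ` carrier R"
    using m by (auto simp: smult_assoc1[symmetric])
qed

lemma cyclic_self: "m \<in> carrier M \<Longrightarrow> m \<in> cyclic_submodule R M m"
  unfolding cyclic_submodule_def by (metis R.one_closed image_eqI smult_one)

lemma cyclic_subset: "\<lbrakk>submodule N R M; m \<in> N\<rbrakk> \<Longrightarrow> cyclic_submodule R M m \<subseteq> N"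
  unfolding cyclic_submodule_def using submodule_smult by blast

lemma cyclic_nonzero: "\<lbrakk>m \<in> carrier M; m \<noteq> \<zero>\<^bsub>M\<^esub>\<rbrakk> \<Longrightarrow> cyclic_submodule R M m \<noteq> {\<zero>\<^bsub>M\<^esub>}"
  using cyclic_self by blast

section \<open>The ideals (N : M) and (0 : m)\<close>

lemma residual_ideal:
  assumes N: "submodule N R M"
  shows "ideal (residual R M N) R"
proof (rule idealI)
  show "ring R" by (rule R.ring_axioms)
  show "subgroup (residual R M N) (add_monoid R)"
  proof (rule R.add.subgroupI)
    show "residual R M N \<subseteq> carrier R" by (auto simp: residual_def)
    have "\<zero> \<in> residual R M N" using submodule_zero[OF N] by (simp add: residual_def)
    then show "residual R M N \<noteq> {}" by blast
    show "\<And>a. a \<in> residual R M N \<Longrightarrow> \<ominus> a \<in> residual R M N"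
      using submoduleE(3)[OF N] by (simp add: residual_def smult_l_minus)
    show "\<And>a b. \<lbrakk>a \<in> residual R M N; b \<in> residual R M N\<rbrakk> \<Longrightarrow> a \<oplus> b \<in> residual R M N"
      using submodule_add[OF N] by (simp add: residual_def smult_l_distr)
  qed
  show "\<And>a x. \<lbrakk>a \<in> residual R M N; x \<in> carrier R\<rbrakk> \<Longrightarrow> x \<otimes> a \<in> residual R M N"
    using N by (auto simp: residual_def smult_assoc1 submodule_smult)
  show "\<And>a x. \<lbrakk>a \<in> residual R M N; x \<in> carrier R\<rbrakk> \<Longrightarrow> a \<otimes> x \<in> residual R M N"
    using N by (auto simp: residual_def smult_assoc1)
qed

lemma residual_smult: "\<lbrakk>r \<in> residual R M N; x \<in> carrier M\<rbrakk> \<Longrightarrow> r \<odot>\<^bsub>M\<^esub> x \<in> N"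
  by (simp add: residual_def)

lemma residual_carrier: "r \<in> residual R M N \<Longrightarrow> r \<in> carrier R"
  by (simp add: residual_def)

lemma elem_annihilator_ideal:
  assumes m: "m \<in> carrier M"
  shows "ideal (elem_annihilator R M m) R"
proof (rule idealI)
  show "ring R" by (rule R.ring_axioms)
  show "subgroup (elem_annihilator R M m) (add_monoid R)"
  proof (rule R.add.subgroupI)
    show "elem_annihilator R M m \<subseteq> carrier R" by (auto simp: elem_annihilator_def)
    have "\<zero> \<in> elem_annihilator R M m" using m by (simp add: elem_annihilator_def)
    then show "elem_annihilator R M m \<noteq> {}" by blast
    show "\<And>a. a \<in> elem_annihilator R M m \<Longrightarrow> \<ominus> a \<in> elem_annihilator R M m"
      using m by (simp add: elem_annihilator_def smult_l_minus)
    show "\<And>a b. \<lbrakk>a \<in> elem_annihilator R M m; b \<in> elem_annihilator R M m\<rbrakk>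
        \<Longrightarrow> a \<oplus> b \<in> elem_annihilator R M m"
      using m by (simp add: elem_annihilator_def smult_l_distr)
  qed
  fix a x assume a: "a \<in> elem_annihilator R M m" and x: "x \<in> carrier R"
  then show "x \<otimes> a \<in> elem_annihilator R M m"
    using m by (simp add: elem_annihilator_def smult_assoc1)
  then show "a \<otimes> x \<in> elem_annihilator R M m"
    using a x R.m_comm by (simp add: elem_annihilator_def)
qed

section \<open>Products of an ideal with a submodule, and powers of an ideal\<close>

lemma ideal_smult_least:
  assumes "submodule K R M" "\<And>a x. \<lbrakk>a \<in> I; x \<in> N\<rbrakk> \<Longrightarrow> a \<odot>\<^bsub>M\<^esub> x \<in> K"
  shows "ideal_smult R M I N \<subseteq> K"
proof
  fix s assume "s \<in> ideal_smult R M I N"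
  then show "s \<in> K"
    by induction (use assms submodule_add in blast)+
qed

lemma ideal_smult_submodule:
  assumes I: "ideal I R" and N: "N \<subseteq> carrier M" "N \<noteq> {}"
  shows "submodule (ideal_smult R M I N) R M"
proof -
  have IR: "\<And>a. a \<in> I \<Longrightarrow> a \<in> carrier R" by (rule ideal.Icarr[OF I])
  have sub: "ideal_smult R M I N \<subseteq> carrier M"
    by (rule ideal_smult_least[OF carrier_is_submodule]) (use IR N in auto)
  have sc: "r \<odot>\<^bsub>M\<^esub> s \<in> ideal_smult R M I N" if "r \<in> carrier R" "s \<in> ideal_smult R M I N" for r s
    using that(2)
  proof induction
    case (smult a x)
    then have "r \<odot>\<^bsub>M\<^esub> (a \<odot>\<^bsub>M\<^esub> x) = (r \<otimes> a) \<odot>\<^bsub>M\<^esub> x"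
      using that(1) IR N by (auto simp: smult_assoc1)
    moreover have "r \<otimes> a \<in> I" using ideal.I_l_closed[OF I] smult that(1) by blast
    ultimately show ?case using smult by (metis ideal_smult.smult)
  next
    case (sum s t)
    then have "s \<in> carrier M" "t \<in> carrier M" using sub by auto
    then show ?case using sum that(1) by (simp add: smult_r_distr ideal_smult.sum)
  qed
  \<comment> \<open>\<open>ideal_smult\<close> has no clause for zero: it arises as
    \<open>\<zero>\<close> times an arbitrary element, which is why \<open>N\<close> must be
    nonempty.\<close>
  obtain x where x: "x \<in> N" using N by blast
  show ?thesis
  proof (rule submoduleI)
    show "ideal_smult R M I N \<subseteq> carrier M" by (rule sub)
    have "\<zero> \<in> I" using I by (simp add: additive_subgroup.zero_closed ideal.axioms(1))
    then have "\<zero> \<odot>\<^bsub>M\<^esub> x \<in> ideal_smult R M I N" using x by (rule ideal_smult.smult)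
    then show "\<zero>\<^bsub>M\<^esub> \<in> ideal_smult R M I N" using x N(1) by (simp add: subset_iff)
    fix s assume s: "s \<in> ideal_smult R M I N"
    then have "\<ominus>\<^bsub>M\<^esub> s = (\<ominus> \<one>) \<odot>\<^bsub>M\<^esub> s" using sub by (auto simp: smult_l_minus)
    then show "\<ominus>\<^bsub>M\<^esub> s \<in> ideal_smult R M I N" using sc[OF _ s, of "\<ominus> \<one>"] by simp
  qed (use sc in \<open>auto intro: ideal_smult.sum\<close>)
qed

text \<open>Both sides are generated by the elements abx with a in I and b in J, as R is
  commutative. The order J(IN) fits \<open>ideal_power\<close>, whose successor multiplies on the
  right, and so yields the recursion \<open>ideal_smult_power_Suc\<close>.\<close>

lemma ideal_smult_prod:
  assumes I: "ideal I R" and J: "ideal J R" and N: "submodule N R M"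
  shows "ideal_smult R M (ideal_prod R I J) N = ideal_smult R M J (ideal_smult R M I N)"
    (is "?L = ?R")
proof
  have IR: "a \<in> I \<Longrightarrow> a \<in> carrier R" and JR: "a \<in> J \<Longrightarrow> a \<in> carrier R" for a
    using ideal.Icarr[OF I] ideal.Icarr[OF J] by blast+
  have sI: "submodule (ideal_smult R M I N) R M"
    using ideal_smult_submodule[OF I] submoduleE(1,2)[OF N] by blast
  have sR: "submodule ?R R M"
    using ideal_smult_submodule[OF J] submoduleE(1,2)[OF sI] by blast
  have IJ: "ideal (ideal_prod R I J) R" using R.ideal_prod_is_ideal[OF I J] .
  have sL: "submodule ?L R M"
    using ideal_smult_submodule[OF IJ] submoduleE(1,2)[OF N] by blast
  show "?L \<subseteq> ?R"
  proof (rule ideal_smult_least[OF sR])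
    fix c x assume "c \<in> ideal_prod R I J" and x: "x \<in> N"
    then have xM: "x \<in> carrier M" using submodule_carrier[OF N] by blast
    from \<open>c \<in> ideal_prod R I J\<close> have "c \<in> carrier R \<and> c \<odot>\<^bsub>M\<^esub> x \<in> ?R"
    proof induction
      case (prod i j)
      then have "(i \<otimes> j) \<odot>\<^bsub>M\<^esub> x = j \<odot>\<^bsub>M\<^esub> (i \<odot>\<^bsub>M\<^esub> x)"
        using IR JR xM by (simp add: smult_assoc1 smult_lcomm)
      then show ?case using prod x IR JR
        by (metis R.m_closed ideal_smult.smult)
    next
      case (sum s t)
      then show ?case using xM by (simp add: smult_l_distr ideal_smult.sum)
    qed
    then show "c \<odot>\<^bsub>M\<^esub> x \<in> ?R" by blast
  qed
  show "?R \<subseteq> ?L"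
  proof (rule ideal_smult_least[OF sL])
    fix b y assume b: "b \<in> J" and y: "y \<in> ideal_smult R M I N"
    from b have "submodule {y \<in> carrier M. b \<odot>\<^bsub>M\<^esub> y \<in> ?L} R M"
      using preimage_submodule[OF JR sL] by blast
    then have "ideal_smult R M I N \<subseteq> {y \<in> carrier M. b \<odot>\<^bsub>M\<^esub> y \<in> ?L}"
    proof (rule ideal_smult_least)
      fix a x assume a: "a \<in> I" and x: "x \<in> N"
      have xM: "x \<in> carrier M" using x submodule_carrier[OF N] by blast
      then have "b \<odot>\<^bsub>M\<^esub> (a \<odot>\<^bsub>M\<^esub> x) = (a \<otimes> b) \<odot>\<^bsub>M\<^esub> x"
        using IR[OF a] JR[OF b] by (simp add: smult_assoc1 smult_lcomm)
      also have "\<dots> \<in> ?L" using a b x by (auto intro: ideal_smult.smult ideal_prod.prod)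
      finally show "a \<odot>\<^bsub>M\<^esub> x \<in> {y \<in> carrier M. b \<odot>\<^bsub>M\<^esub> y \<in> ?L}" using xM IR[OF a] by auto
    qed
    then show "b \<odot>\<^bsub>M\<^esub> y \<in> ?L" using y by blast
  qed
qed

lemma ideal_power_ideal: "ideal I R \<Longrightarrow> ideal (ideal_power R I n) R"
  by (induction n) (auto simp: ideals_set_def nat_pow_def R.oneideal R.ideal_prod_is_ideal)

lemma ideal_smult_power_Suc:
  assumes "ideal I R"
  shows "ideal_smult R M (ideal_power R I (Suc n)) (carrier M)
    = ideal_smult R M I (ideal_smult R M (ideal_power R I n) (carrier M))"
proof -
  have "ideal_power R I (Suc n) = ideal_prod R (ideal_power R I n) I"
    by (simp add: ideals_set_def nat_pow_def)
  then show ?thesis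
    using ideal_smult_prod[OF ideal_power_ideal[OF assms] assms carrier_is_submodule] by simp
qed

lemma ideal_smult_power_0: "ideal_smult R M (ideal_power R I 0) (carrier M) = carrier M"
proof
  show "ideal_smult R M (ideal_power R I 0) (carrier M) \<subseteq> carrier M"
    by (rule ideal_smult_least[OF carrier_is_submodule]) (auto simp: ideals_set_def nat_pow_def)
  show "carrier M \<subseteq> ideal_smult R M (ideal_power R I 0) (carrier M)"
  proof
    fix x assume "x \<in> carrier M"
    then show "x \<in> ideal_smult R M (ideal_power R I 0) (carrier M)"
      using ideal_smult.smult[where a=\<one> and I="carrier R" and x=x and N="carrier M" and M=M]
      by (simp add: ideals_set_def nat_pow_def)
  qed
qed

section \<open>Vanishing products of submodules\<close>

text \<open>The condition NK = 0 on elements, free of the finite sums in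
  \<open>submodule_prod\<close>; \<open>submodule_prod_zero_iff\<close> is the translation.\<close>

definition annih :: "'c set \<Rightarrow> 'c set \<Rightarrow> bool" where
  "annih N K \<longleftrightarrow> (\<forall>r \<in> residual R M N. \<forall>s \<in> residual R M K. \<forall>x \<in> carrier M.
     r \<odot>\<^bsub>M\<^esub> (s \<odot>\<^bsub>M\<^esub> x) = \<zero>\<^bsub>M\<^esub>)"

lemma annih_commute: "annih N K \<longleftrightarrow> annih K N"
  unfolding annih_def using smult_lcomm residual_carrier by metis

lemma submodule_prod_submodule:
  assumes "submodule N R M" "submodule K R M"
  shows "submodule (submodule_prod R M N K) R M"
  unfolding submodule_prod_def
  using ideal_smult_submodule[OF R.ideal_prod_is_ideal[OF residual_ideal residual_ideal, OF assms]]
    M.zero_closed by blast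

text \<open>By \<open>ideal_smult_prod\<close>, NK is (K : M)((N : M)M), so the claim is checked on
  generators in two rounds, the inner one inside a preimage submodule.\<close>

lemma submodule_prod_least:
  assumes N: "submodule N R M" and K: "submodule K R M" and L: "submodule L R M"
    and "\<And>r s x. \<lbrakk>r \<in> residual R M N; s \<in> residual R M K; x \<in> carrier M\<rbrakk> \<Longrightarrow> r \<odot>\<^bsub>M\<^esub> (s \<odot>\<^bsub>M\<^esub> x) \<in> L"
  shows "submodule_prod R M N K \<subseteq> L"
  unfolding submodule_prod_def
    ideal_smult_prod[OF residual_ideal residual_ideal, OF N K carrier_is_submodule]
proof (rule ideal_smult_least[OF L])
  fix s y assume s: "s \<in> residual R M K"
    and y: "y \<in> ideal_smult R M (residual R M N) (carrier M)"
  have "ideal_smult R M (residual R M N) (carrier M) \<subseteq> {y \<in> carrier M. s \<odot>\<^bsub>M\<^esub> y \<in> L}"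
  proof (rule ideal_smult_least[OF preimage_submodule[OF residual_carrier[OF s] L]])
    fix r x assume r: "r \<in> residual R M N" and x: "x \<in> carrier M"
    then have "s \<odot>\<^bsub>M\<^esub> (r \<odot>\<^bsub>M\<^esub> x) \<in> L"
      using assms(4)[OF r s x] smult_lcomm[of s r x] residual_carrier[OF r] residual_carrier[OF s] by simp
    then show "r \<odot>\<^bsub>M\<^esub> x \<in> {y \<in> carrier M. s \<odot>\<^bsub>M\<^esub> y \<in> L}"
      using x residual_carrier[OF r] by simp
  qed
  then show "s \<odot>\<^bsub>M\<^esub> y \<in> L" using y by blast
qed

lemma submodule_prod_zero_iff:
  assumes N: "submodule N R M" and K: "submodule K R M"
  shows "submodule_prod R M N K = {\<zero>\<^bsub>M\<^esub>} \<longleftrightarrow> annih N K"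
proof
  assume prod0: "submodule_prod R M N K = {\<zero>\<^bsub>M\<^esub>}"
  show "annih N K"
    unfolding annih_def
  proof (intro ballI)
    fix r s x assume rs: "r \<in> residual R M N" "s \<in> residual R M K" and x: "x \<in> carrier M"
    then have "(r \<otimes> s) \<odot>\<^bsub>M\<^esub> x \<in> submodule_prod R M N K"
      unfolding submodule_prod_def by (auto intro: ideal_smult.smult ideal_prod.prod)
    then show "r \<odot>\<^bsub>M\<^esub> (s \<odot>\<^bsub>M\<^esub> x) = \<zero>\<^bsub>M\<^esub>"
      using prod0 rs x by (simp add: smult_assoc1 residual_carrier)
  qed
next
  assume "annih N K"
  then have "submodule_prod R M N K \<subseteq> {\<zero>\<^bsub>M\<^esub>}"
    by (intro submodule_prod_least[OF N K zero_submodule]) (simp add: annih_def)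
  then show "submodule_prod R M N K = {\<zero>\<^bsub>M\<^esub>}"
    using submodule_zero[OF submodule_prod_submodule[OF N K]] by blast
qed

lemma annihI:
  assumes "\<And>r s x. \<lbrakk>r \<in> carrier R; s \<in> carrier R; x \<in> carrier M;
      \<And>y. y \<in> carrier M \<Longrightarrow> r \<odot>\<^bsub>M\<^esub> y \<in> N; \<And>y. y \<in> carrier M \<Longrightarrow> s \<odot>\<^bsub>M\<^esub> y \<in> K\<rbrakk>
    \<Longrightarrow> r \<odot>\<^bsub>M\<^esub> (s \<odot>\<^bsub>M\<^esub> x) = \<zero>\<^bsub>M\<^esub>"
  shows "annih N K"
  unfolding annih_def residual_def using assms by simp

section \<open>Generators of simple submodules\<close>

text \<open>Says that Rm is a simple module, in the form in which the descending chain condition on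
  principal ideals delivers it.\<close>

definition simple_elem :: "'c \<Rightarrow> bool" where
  "simple_elem m \<longleftrightarrow> m \<in> carrier M \<and> m \<noteq> \<zero>\<^bsub>M\<^esub> \<and>
     (\<forall>s \<in> carrier R. s \<odot>\<^bsub>M\<^esub> m = \<zero>\<^bsub>M\<^esub> \<or> (\<exists>t \<in> carrier R. t \<odot>\<^bsub>M\<^esub> (s \<odot>\<^bsub>M\<^esub> m) = m))"

text \<open>A nonzero x = sm has m among its multiples, so m lies in every submodule that contains
  x.\<close>

lemma simple_elem_cyclic_subset:
  assumes m: "simple_elem m" and N: "submodule N R M" and x: "x \<in> N" "x \<in> cyclic_submodule R M m" "x \<noteq> \<zero>\<^bsub>M\<^esub>"
  shows "cyclic_submodule R M m \<subseteq> N"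
proof -
  obtain s where s: "s \<in> carrier R" "x = s \<odot>\<^bsub>M\<^esub> m" using x(2) unfolding cyclic_submodule_def by blast
  then obtain t where "t \<in> carrier R" "t \<odot>\<^bsub>M\<^esub> x = m" using m x(3) unfolding simple_elem_def by blast
  then have "m \<in> N" using submodule_smult[OF N] x(1) by metis
  then show ?thesis by (rule cyclic_subset[OF N])
qed

lemma simple_elem_minimal:
  assumes "simple_elem m"
  shows "minimal_submodule (cyclic_submodule R M m) R M"
proof -
  have m: "m \<in> carrier M" "m \<noteq> \<zero>\<^bsub>M\<^esub>" using assms by (auto simp: simple_elem_def)
  have "K = cyclic_submodule R M m"
    if K: "submodule K R M" "K \<noteq> {\<zero>\<^bsub>M\<^esub>}" "K \<subseteq> cyclic_submodule R M m" for K
  proof -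
    obtain x where "x \<in> K" "x \<noteq> \<zero>\<^bsub>M\<^esub>" using K(2) submodule_zero[OF K(1)] by blast
    then show ?thesis using simple_elem_cyclic_subset[OF assms K(1)] K(3) by blast
  qed
  then show ?thesis
    unfolding minimal_submodule_def using cyclic_is_submodule cyclic_nonzero m by blast
qed

text \<open>If s does not kill m, then tsm = m for some t, so 1 - ts kills m. An ideal that contains
  both (0 : m) and s therefore contains 1.\<close>

lemma simple_elem_annihilator_maximal:
  assumes "simple_elem m"
  shows "maximalideal (elem_annihilator R M m) R"
proof -
  have m: "m \<in> carrier M" "m \<noteq> \<zero>\<^bsub>M\<^esub>" using assms by (auto simp: simple_elem_def)
  let ?A = "elem_annihilator R M m"
  show ?thesis
  proof (rule maximalidealI[OF elem_annihilator_ideal[OF m(1)]])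
    have "\<one> \<notin> ?A" using m by (simp add: elem_annihilator_def)
    then show "carrier R \<noteq> ?A" by blast
    fix J assume J: "ideal J R" "?A \<subseteq> J" "J \<subseteq> carrier R"
    show "J = ?A \<or> J = carrier R"
    proof (rule disjCI)
      assume "J \<noteq> carrier R"
      then have J1: "\<one> \<notin> J" using ideal.one_imp_carrier[OF J(1)] by blast
      have "s \<in> ?A" if s: "s \<in> J" for s
      proof (rule ccontr)
        assume "s \<notin> ?A"
        moreover have sR: "s \<in> carrier R" using s J by blast
        ultimately obtain t where t: "t \<in> carrier R" "t \<odot>\<^bsub>M\<^esub> (s \<odot>\<^bsub>M\<^esub> m) = m"
          using assms unfolding simple_elem_def elem_annihilator_def by blast
        then have "(\<one> \<ominus> t \<otimes> s) \<in> ?A"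
          using m sR by (simp add: elem_annihilator_def R.minus_eq smult_l_distr smult_l_minus
              smult_assoc1 M.r_neg)
        moreover have "t \<otimes> s \<in> J" using ideal.I_l_closed[OF J(1) s t(1)] .
        ultimately have "(\<one> \<ominus> t \<otimes> s) \<oplus> t \<otimes> s \<in> J"
          using J(2) additive_subgroup.a_closed[OF ideal.axioms(1)[OF J(1)]] by blast
        moreover have "(\<one> \<ominus> t \<otimes> s) \<oplus> t \<otimes> s = \<one>"
          using sR t(1) by (simp add: R.minus_eq R.a_assoc R.l_neg)
        ultimately show False using J1 by simp
      qed
      then show "J = ?A" using J(2) by blast
    qed
  qed
qed

text \<open>The element rsx = srx lies in N because of r and in K because of s.\<close>

lemma annih_if_disjoint:
  assumes "submodule N R M" "submodule K R M" "N \<inter> K = {\<zero>\<^bsub>M\<^esub>}"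
  shows "annih N K"
proof (rule annihI)
  fix r s x assume r: "r \<in> carrier R" and s: "s \<in> carrier R" and x: "x \<in> carrier M"
    and rN: "\<And>y. y \<in> carrier M \<Longrightarrow> r \<odot>\<^bsub>M\<^esub> y \<in> N"
    and sK: "\<And>y. y \<in> carrier M \<Longrightarrow> s \<odot>\<^bsub>M\<^esub> y \<in> K"
  have "r \<odot>\<^bsub>M\<^esub> (s \<odot>\<^bsub>M\<^esub> x) \<in> N" using rN s x by blast
  moreover have "r \<odot>\<^bsub>M\<^esub> (s \<odot>\<^bsub>M\<^esub> x) \<in> K" using sK[of "r \<odot>\<^bsub>M\<^esub> x"] r x smult_lcomm[OF r s x] by simp
  ultimately show "r \<odot>\<^bsub>M\<^esub> (s \<odot>\<^bsub>M\<^esub> x) = \<zero>\<^bsub>M\<^esub>" using assms by blast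
qed

section \<open>Submodules regarded as modules\<close>

lemma submodule_of_submodule:
  assumes "submodule N R M" "submodule K R (M\<lparr>carrier := N\<rparr>)"
  shows "submodule K R M" "K \<subseteq> N"
proof -
  interpret N: module R "M\<lparr>carrier := N\<rparr>"
    by (rule submodule.submodule_is_module[OF assms(1) module_axioms])
  show KN: "K \<subseteq> N" using N.submoduleE(1)[OF assms(2)] by simp
  show "submodule K R M"
  proof (rule submoduleI)
    show "K \<subseteq> carrier M" using KN submoduleE(1)[OF assms(1)] by blast
    show "\<zero>\<^bsub>M\<^esub> \<in> K" using N.submodule_zero[OF assms(2)] by simp
    show "\<And>a x. \<lbrakk>a \<in> carrier R; x \<in> K\<rbrakk> \<Longrightarrow> a \<odot>\<^bsub>M\<^esub> x \<in> K"
      using N.submodule_smult[OF assms(2)] by simp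
    \<comment> \<open>The negative is obtained as the scalar -1 times x: the inverse of the
      restricted structure is defined relative to its own carrier.\<close>
    then show "\<ominus>\<^bsub>M\<^esub> x \<in> K" if "x \<in> K" for x
      using that smult_l_minus[of \<one> x] KN submodule_carrier[OF assms(1)]
      by (metis R.a_inv_closed R.one_closed smult_one subsetD)
    show "\<And>a b. \<lbrakk>a \<in> K; b \<in> K\<rbrakk> \<Longrightarrow> a \<oplus>\<^bsub>M\<^esub> b \<in> K"
      using N.submodule_add[OF assms(2)] by simp
  qed
qed

lemma submodule_restrict:
  assumes "submodule N R M" "submodule K R M" "K \<subseteq> N"
  shows "submodule K R (M\<lparr>carrier := N\<rparr>)"
proof -
  have "module R (M\<lparr>carrier := N\<rparr>)"
    by (rule submodule.submodule_is_module[OF assms(1) module_axioms])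
  moreover have "module R ((M\<lparr>carrier := N\<rparr>)\<lparr>carrier := K\<rparr>)"
    using submodule.submodule_is_module[OF assms(2) module_axioms] by simp
  ultimately show ?thesis
    using module.module_incl_imp_submodule[of R "M\<lparr>carrier := N\<rparr>" K] assms(3) by simp
qed

lemma simple_submodule_iff:
  assumes N: "submodule N R M"
  shows "simple_module R (M\<lparr>carrier := N\<rparr>) \<longleftrightarrow> N \<noteq> {\<zero>\<^bsub>M\<^esub>} \<and>
    (\<forall>K. submodule K R M \<and> K \<subseteq> N \<longrightarrow> K = {\<zero>\<^bsub>M\<^esub>} \<or> K = N)"
proof -
  have "module R (M\<lparr>carrier := N\<rparr>)"
    by (rule submodule.submodule_is_module[OF N module_axioms])
  moreover have "submodule K R (M\<lparr>carrier := N\<rparr>) \<longleftrightarrow> submodule K R M \<and> K \<subseteq> N" for K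
    using submodule_of_submodule[OF N, of K] submodule_restrict[OF N, of K] by blast
  ultimately show ?thesis by (simp add: simple_module_def)
qed

text \<open>Writing rx = cz gives rsx = s(cz) = c(sz), and sz lies in K, which c kills.\<close>

lemma annih_imageI:
  assumes c: "c \<in> carrier R" and K: "\<And>y. y \<in> K \<Longrightarrow> c \<odot>\<^bsub>M\<^esub> y = \<zero>\<^bsub>M\<^esub>"
  shows "annih ((\<lambda>x. c \<odot>\<^bsub>M\<^esub> x) ` carrier M) K"
proof (rule annihI)
  fix r s x assume r: "r \<in> carrier R" and s: "s \<in> carrier R" and x: "x \<in> carrier M"
    and rN: "\<And>y. y \<in> carrier M \<Longrightarrow> r \<odot>\<^bsub>M\<^esub> y \<in> (\<lambda>x. c \<odot>\<^bsub>M\<^esub> x) ` carrier M"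
    and sK: "\<And>y. y \<in> carrier M \<Longrightarrow> s \<odot>\<^bsub>M\<^esub> y \<in> K"
  obtain z where z: "z \<in> carrier M" "r \<odot>\<^bsub>M\<^esub> x = c \<odot>\<^bsub>M\<^esub> z" using rN[OF x] by blast
  have "r \<odot>\<^bsub>M\<^esub> (s \<odot>\<^bsub>M\<^esub> x) = s \<odot>\<^bsub>M\<^esub> (c \<odot>\<^bsub>M\<^esub> z)" using smult_lcomm[OF r s x] z by simp
  also have "\<dots> = \<zero>\<^bsub>M\<^esub>" using smult_lcomm[OF s c z(1)] K[OF sK[OF z(1)]] by simp
  finally show "r \<odot>\<^bsub>M\<^esub> (s \<odot>\<^bsub>M\<^esub> x) = \<zero>\<^bsub>M\<^esub>" .
qed

text \<open>Scalars in (K : M) map M into K, so it suffices that (N : M) kills K.\<close>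

lemma annihI_right:
  assumes "\<And>r y. \<lbrakk>r \<in> residual R M N; y \<in> K\<rbrakk> \<Longrightarrow> r \<odot>\<^bsub>M\<^esub> y = \<zero>\<^bsub>M\<^esub>"
  shows "annih N K"
  unfolding annih_def
proof (intro ballI)
  fix r s x assume "r \<in> residual R M N" "s \<in> residual R M K" "x \<in> carrier M"
  then show "r \<odot>\<^bsub>M\<^esub> (s \<odot>\<^bsub>M\<^esub> x) = \<zero>\<^bsub>M\<^esub>" using assms residual_smult by blast
qed

end

section \<open>The graph of a module over an Artinian ring\<close>

text \<open>The part \<open>U\<close> of the bipartition is the singleton of the centre
  \<open>c\<close>, and \<open>V\<close> consists of all other vertices.\<close>

lemma star_graph_iff:
  assumes irr: "\<And>x. (x, x) \<notin> parcs G" and sym: "\<And>x y. (x, y) \<in> parcs G \<Longrightarrow> (y, x) \<in> parcs G"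
    and verts: "\<And>x y. (x, y) \<in> parcs G \<Longrightarrow> x \<in> pverts G"
  shows "star_graph G \<longleftrightarrow> (\<exists>c \<in> pverts G. (\<forall>x \<in> pverts G - {c}. (c, x) \<in> parcs G) \<and>
    (\<forall>x y. (x, y) \<in> parcs G \<longrightarrow> x = c \<or> y = c))"
proof
  assume "star_graph G"
  then obtain U V where UV: "pverts G = U \<union> V" "U \<inter> V = {}" "card U = 1" "parcs G = U \<times> V \<union> V \<times> U"
    unfolding star_graph_def by blast
  then obtain c where "U = {c}" using card_1_singletonE by blast
  then show "\<exists>c \<in> pverts G. (\<forall>x \<in> pverts G - {c}. (c, x) \<in> parcs G) \<and>
    (\<forall>x y. (x, y) \<in> parcs G \<longrightarrow> x = c \<or> y = c)"
    using UV by auto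
next
  assume "\<exists>c \<in> pverts G. (\<forall>x \<in> pverts G - {c}. (c, x) \<in> parcs G) \<and>
    (\<forall>x y. (x, y) \<in> parcs G \<longrightarrow> x = c \<or> y = c)"
  then obtain c where c: "c \<in> pverts G" "\<forall>x \<in> pverts G - {c}. (c, x) \<in> parcs G"
    "\<And>x y. (x, y) \<in> parcs G \<Longrightarrow> x = c \<or> y = c" by blast
  let ?V = "pverts G - {c}"
  have "parcs G = {c} \<times> ?V \<union> ?V \<times> {c}"
  proof (rule subset_antisym; rule subsetI)
    fix e assume e: "e \<in> parcs G"
    obtain x y where xy: "e = (x, y)" by (cases e)
    then have "x \<noteq> y" using e irr by blast
    moreover have "x \<in> pverts G" "y \<in> pverts G" using e xy verts sym by blast+
    ultimately show "e \<in> {c} \<times> ?V \<union> ?V \<times> {c}" using e xy c(3) by auto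
  next
    fix e assume "e \<in> {c} \<times> ?V \<union> ?V \<times> {c}"
    then show "e \<in> parcs G" using c(2) sym by auto
  qed
  moreover have "pverts G = {c} \<union> ?V" using c(1) by blast
  moreover have "{c} \<inter> ?V = {}" "card {c} = 1" by auto
  ultimately show "star_graph G" unfolding star_graph_def by blast
qed

section \<open>Descending chains of principal ideals\<close>

text \<open>Otherwise some \<open>f\<close> picks for each r in C a multiplier such that the product
  stays in C but does not generate r. Iterating it gives a chain of principal ideals that never
  becomes stationary.\<close>

lemma (in artinian_ring) minimal_principal:
  assumes "C \<subseteq> carrier R" "C \<noteq> {}" and comm: "cring R"
  shows "\<exists>r \<in> C. \<forall>s \<in> carrier R. s \<otimes> r \<in> C \<longrightarrow> (\<exists>t \<in> carrier R. r = t \<otimes> (s \<otimes> r))"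
proof (rule ccontr)
  interpret cring R by (rule comm)
  assume "\<not> ?thesis"
  then obtain f where f: "\<And>r. r \<in> C \<Longrightarrow> f r \<in> carrier R \<and> f r \<otimes> r \<in> C \<and>
      (\<forall>t \<in> carrier R. r \<noteq> t \<otimes> (f r \<otimes> r))"
    by metis
  obtain c where c: "c \<in> C" using assms by blast
  define g where "g n = ((\<lambda>r. f r \<otimes> r) ^^ n) c" for n
  have g: "g n \<in> C" for n
    by (induction n) (use c f in \<open>auto simp: g_def\<close>)
  have gR: "g n \<in> carrier R" for n using g assms(1) by blast
  have gSuc: "g (Suc n) = f (g n) \<otimes> g n" for n by (simp add: g_def)
  have "\<exists>k. \<forall>n\<ge>k. PIdl (g n) = PIdl (g k)"
  proof (rule descending_chain)
    show "ideal (PIdl (g n)) R" for n using gR by (rule cgenideal_ideal)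
    show "PIdl (g (Suc n)) \<subseteq> PIdl (g n)" for n
    proof (rule cgenideal_minimal[OF cgenideal_ideal[OF gR]])
      show "g (Suc n) \<in> PIdl (g n)"
        unfolding gSuc cgenideal_def using f[OF g[of n]] by blast
    qed
  qed
  then obtain k where "PIdl (g (Suc k)) = PIdl (g k)" by (metis le_SucI order_refl)
  then have "g k \<in> PIdl (g (Suc k))" using cgenideal_self[OF gR] by blast
  then obtain t where "t \<in> carrier R" "g k = t \<otimes> g (Suc k)" unfolding cgenideal_def by blast
  then show False using f[OF g[of k]] gSuc by auto
qed

text \<open>The chain of ideals generated by the powers of y becomes stationary. For w the power
  found here, w = zww makes zw idempotent; the exponent is positive so that w lies in every ideal
  containing y.\<close>

lemma (in artinian_ring) power_idempotent:
  assumes comm: "cring R" and y: "y \<in> carrier R"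
  shows "\<exists>n z. z \<in> carrier R \<and> y [^] Suc n = z \<otimes> (y [^] Suc n \<otimes> y [^] Suc n)"
proof -
  interpret cring R by (rule comm)
  have "\<exists>k. \<forall>n\<ge>(k::nat). PIdl (y [^] n) = PIdl (y [^] k)"
  proof (rule descending_chain)
    show "ideal (PIdl (y [^] n)) R" for n :: nat using y by (simp add: cgenideal_ideal)
    show "PIdl (y [^] Suc n) \<subseteq> PIdl (y [^] n)" for n :: nat
    proof (rule cgenideal_minimal[OF cgenideal_ideal])
      show "y [^] Suc n \<in> PIdl (y [^] n)"
        unfolding cgenideal_def using y m_comm by auto
    qed (use y in simp)
  qed
  then obtain k :: nat where k: "\<And>n. n \<ge> k \<Longrightarrow> PIdl (y [^] n) = PIdl (y [^] k)" by blast
  have "PIdl (y [^] Suc k) = PIdl (y [^] (Suc k + Suc k))"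
    using k[of "Suc k"] k[of "Suc k + Suc k"] by simp
  then have "y [^] Suc k \<in> PIdl (y [^] (Suc k + Suc k))"
    using cgenideal_self[of "y [^] Suc k"] y by simp
  then obtain z where "z \<in> carrier R" "y [^] Suc k = z \<otimes> y [^] (Suc k + Suc k)"
    unfolding cgenideal_def by blast
  then show ?thesis using nat_pow_mult[OF y] by metis
qed

locale artinian_module = module R M + artinian_ring R for R (structure) and M (structure)
begin

abbreviation \<Lambda> where "\<Lambda> \<equiv> nonzero_proper_submodules R M"

lemma nonzero_properD:
  assumes "N \<in> \<Lambda>"
  shows "submodule N R M" "N \<noteq> {\<zero>\<^bsub>M\<^esub>}" "N \<noteq> carrier M"
  using assms unfolding nonzero_proper_submodules_def proper_submodule_def by auto

lemma nonzero_properI: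
  assumes "submodule N R M" "N \<noteq> {\<zero>\<^bsub>M\<^esub>}" "N \<noteq> carrier M"
  shows "N \<in> \<Lambda>"
  using assms unfolding nonzero_proper_submodules_def proper_submodule_def by auto

text \<open>This is \<open>minimal_principal\<close> for the set of r with rv outside K. With K =
  {0} it produces simple elements, and with larger K it takes the place of Nakayama's lemma.\<close>

lemma minimal_multiple:
  assumes v: "v \<in> carrier M" "v \<notin> K"
  obtains r where "r \<in> carrier R" "r \<odot>\<^bsub>M\<^esub> v \<notin> K"
    "\<And>s. s \<in> carrier R \<Longrightarrow> s \<odot>\<^bsub>M\<^esub> (r \<odot>\<^bsub>M\<^esub> v) \<in> K \<or>
       (\<exists>t \<in> carrier R. t \<odot>\<^bsub>M\<^esub> (s \<odot>\<^bsub>M\<^esub> (r \<odot>\<^bsub>M\<^esub> v)) = r \<odot>\<^bsub>M\<^esub> v)"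
proof -
  let ?C = "{r \<in> carrier R. r \<odot>\<^bsub>M\<^esub> v \<notin> K}"
  have "\<one> \<in> ?C" using v by simp
  then obtain r where r: "r \<in> ?C"
      "\<forall>s \<in> carrier R. s \<otimes> r \<in> ?C \<longrightarrow> (\<exists>t \<in> carrier R. r = t \<otimes> (s \<otimes> r))"
    using minimal_principal[of ?C, OF _ _ R.is_cring] by blast
  show thesis
  proof (rule that[of r])
    fix s assume s: "s \<in> carrier R"
    show "s \<odot>\<^bsub>M\<^esub> (r \<odot>\<^bsub>M\<^esub> v) \<in> K \<or> (\<exists>t \<in> carrier R. t \<odot>\<^bsub>M\<^esub> (s \<odot>\<^bsub>M\<^esub> (r \<odot>\<^bsub>M\<^esub> v)) = r \<odot>\<^bsub>M\<^esub> v)"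
    proof (rule disjCI)
      assume "\<not> (\<exists>t \<in> carrier R. t \<odot>\<^bsub>M\<^esub> (s \<odot>\<^bsub>M\<^esub> (r \<odot>\<^bsub>M\<^esub> v)) = r \<odot>\<^bsub>M\<^esub> v)"
      moreover have "t \<odot>\<^bsub>M\<^esub> (s \<odot>\<^bsub>M\<^esub> (r \<odot>\<^bsub>M\<^esub> v)) = (t \<otimes> (s \<otimes> r)) \<odot>\<^bsub>M\<^esub> v"
        if "t \<in> carrier R" for t
        using that s r(1) v(1) by (simp add: smult_assoc1)
      ultimately have "s \<otimes> r \<notin> ?C" using r(2) s by fastforce
      then show "s \<odot>\<^bsub>M\<^esub> (r \<odot>\<^bsub>M\<^esub> v) \<in> K" using s r(1) v(1) by (simp add: smult_assoc1)
    qed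
  qed (use r in auto)
qed

lemma simple_elem_exists:
  assumes "v \<in> carrier M" "v \<noteq> \<zero>\<^bsub>M\<^esub>"
  obtains r where "r \<in> carrier R" "simple_elem (r \<odot>\<^bsub>M\<^esub> v)"
proof -
  obtain r where r: "r \<in> carrier R" "r \<odot>\<^bsub>M\<^esub> v \<notin> {\<zero>\<^bsub>M\<^esub>}"
    "\<And>s. s \<in> carrier R \<Longrightarrow> s \<odot>\<^bsub>M\<^esub> (r \<odot>\<^bsub>M\<^esub> v) \<in> {\<zero>\<^bsub>M\<^esub>} \<or>
       (\<exists>t \<in> carrier R. t \<odot>\<^bsub>M\<^esub> (s \<odot>\<^bsub>M\<^esub> (r \<odot>\<^bsub>M\<^esub> v)) = r \<odot>\<^bsub>M\<^esub> v)"
    using minimal_multiple[of v "{\<zero>\<^bsub>M\<^esub>}"] assms by blast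
  then have "simple_elem (r \<odot>\<^bsub>M\<^esub> v)" using assms by (auto simp: simple_elem_def)
  with r that show thesis by blast
qed

lemma simple_elem_in_submodule:
  assumes "submodule N R M" "N \<noteq> {\<zero>\<^bsub>M\<^esub>}"
  obtains m where "m \<in> N" "simple_elem m"
proof -
  obtain v where v: "v \<in> N" "v \<noteq> \<zero>\<^bsub>M\<^esub>" using assms submodule_zero by blast
  then obtain r where "r \<in> carrier R" "simple_elem (r \<odot>\<^bsub>M\<^esub> v)"
    using simple_elem_exists submodule_carrier[OF assms(1)] by blast
  then show thesis using that submodule_smult[OF assms(1)] v by blast
qed

end

section \<open>Vertices and edges of the graph when M is not a vertex\<close>

locale nonvertex_artinian_module = artinian_module +
  assumes not_vertex: "carrier M \<notin> pverts (AG R M)"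
    and nil_annihilator: "nil_ideal (annihilator R M) R"
begin

lemma pverts_AG_iff:
  "N \<in> pverts (AG R M) \<longleftrightarrow> submodule N R M \<and> N \<noteq> {\<zero>\<^bsub>M\<^esub>} \<and> (\<exists>K \<in> \<Lambda>. annih N K)"
  unfolding AG_def Let_def using submodule_prod_zero_iff nonzero_properD(1) by auto

lemma verts_iff: "N \<in> pverts (AG R M) \<longleftrightarrow> N \<in> \<Lambda> \<and> (\<exists>K \<in> \<Lambda>. annih N K)"
proof
  assume N: "N \<in> pverts (AG R M)"
  then have "N \<noteq> carrier M" using not_vertex by blast
  then show "N \<in> \<Lambda> \<and> (\<exists>K \<in> \<Lambda>. annih N K)"
    using N nonzero_properI[of N] unfolding pverts_AG_iff by blast
qed (use nonzero_properD in \<open>auto simp: pverts_AG_iff\<close>)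

text \<open>Adjacent submodules witness for each other that they are vertices, so only nonzero and
  proper remains of the vertex condition.\<close>

lemma arcs_iff: "(N, K) \<in> parcs (AG R M) \<longleftrightarrow> N \<in> \<Lambda> \<and> K \<in> \<Lambda> \<and> N \<noteq> K \<and> annih N K"
proof -
  have "(N, K) \<in> parcs (AG R M) \<longleftrightarrow> N \<in> pverts (AG R M) \<and> K \<in> pverts (AG R M) \<and> N \<noteq> K
      \<and> submodule_prod R M N K = {\<zero>\<^bsub>M\<^esub>}"
    by (simp add: AG_def Let_def)
  also have "\<dots> \<longleftrightarrow> N \<in> pverts (AG R M) \<and> K \<in> pverts (AG R M) \<and> N \<noteq> K \<and> annih N K"
    using submodule_prod_zero_iff[of N K] by (auto simp: pverts_AG_iff)
  finally show ?thesis using annih_commute[of N K] by (auto simp: verts_iff)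
qed

lemma AG_star_iff:
  "star_graph (AG R M) \<longleftrightarrow> (\<exists>c \<in> pverts (AG R M).
     (\<forall>N \<in> pverts (AG R M) - {c}. annih c N) \<and>
     (\<forall>N \<in> \<Lambda>. \<forall>K \<in> \<Lambda>. N \<noteq> K \<and> annih N K \<longrightarrow> N = c \<or> K = c))"
proof -
  have "star_graph (AG R M) \<longleftrightarrow> (\<exists>c \<in> pverts (AG R M).
      (\<forall>N \<in> pverts (AG R M) - {c}. (c, N) \<in> parcs (AG R M)) \<and>
      (\<forall>N K. (N, K) \<in> parcs (AG R M) \<longrightarrow> N = c \<or> K = c))"
  proof (rule star_graph_iff)
    show "(K, N) \<in> parcs (AG R M)" if "(N, K) \<in> parcs (AG R M)" for N K
      using that annih_commute[of N K] unfolding arcs_iff by blast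
    show "N \<in> pverts (AG R M)" if "(N, K) \<in> parcs (AG R M)" for N K
      using that unfolding arcs_iff verts_iff by blast
  qed (simp add: arcs_iff)
  also have "\<dots> \<longleftrightarrow> (\<exists>c \<in> pverts (AG R M).
     (\<forall>N \<in> pverts (AG R M) - {c}. annih c N) \<and>
     (\<forall>N \<in> \<Lambda>. \<forall>K \<in> \<Lambda>. N \<noteq> K \<and> annih N K \<longrightarrow> N = c \<or> K = c))"
  proof (intro bex_cong[OF refl] conj_cong ball_cong[OF refl])
    show "(c, N) \<in> parcs (AG R M) \<longleftrightarrow> annih c N"
      if "c \<in> pverts (AG R M)" "N \<in> pverts (AG R M) - {c}" for c N
      using that verts_iff[of c] verts_iff[of N] arcs_iff[of c N] by blast
    show "(\<forall>N K. (N, K) \<in> parcs (AG R M) \<longrightarrow> N = c \<or> K = c) \<longleftrightarrow>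
        (\<forall>N \<in> \<Lambda>. \<forall>K \<in> \<Lambda>. N \<noteq> K \<and> annih N K \<longrightarrow> N = c \<or> K = c)" for c
      unfolding arcs_iff by blast
  qed
  finally show ?thesis .
qed

lemma not_annih_carrier: "N \<in> \<Lambda> \<Longrightarrow> carrier M \<noteq> {\<zero>\<^bsub>M\<^esub>} \<Longrightarrow> \<not> annih (carrier M) N"
  using not_vertex carrier_is_submodule unfolding pverts_AG_iff by blast

text \<open>If (N : M)M were zero, N would be a witness that M itself is a vertex.\<close>

lemma residual_nonzero:
  assumes "N \<in> \<Lambda>"
  obtains r x where "r \<in> residual R M N" "x \<in> carrier M" "r \<odot>\<^bsub>M\<^esub> x \<noteq> \<zero>\<^bsub>M\<^esub>"
proof -
  have "carrier M \<noteq> {\<zero>\<^bsub>M\<^esub>}"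
    using nonzero_properD[OF assms] submodule_carrier submodule_zero by blast
  then obtain s r x where "s \<in> carrier R" "r \<in> residual R M N" "x \<in> carrier M"
      "s \<odot>\<^bsub>M\<^esub> (r \<odot>\<^bsub>M\<^esub> x) \<noteq> \<zero>\<^bsub>M\<^esub>"
    using not_annih_carrier[OF assms] residual_carrier unfolding annih_def by blast
  then show thesis using that smult_r_null by metis
qed

text \<open>The witness K may equal c, which admits the graph with a single vertex.\<close>

lemma star_graphI:
  assumes c: "c \<in> \<Lambda>" "K \<in> \<Lambda>" "annih c K"
    and adj: "\<And>N. \<lbrakk>N \<in> \<Lambda>; N \<noteq> c\<rbrakk> \<Longrightarrow> annih c N"
    and only: "\<And>N K. \<lbrakk>N \<in> \<Lambda>; K \<in> \<Lambda>; N \<noteq> K; annih N K\<rbrakk> \<Longrightarrow> N = c \<or> K = c"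
  shows "star_graph (AG R M)"
  unfolding AG_star_iff
proof (intro bexI[of _ c] conjI ballI impI)
  show "c \<in> pverts (AG R M)" unfolding verts_iff using c by blast
  show "annih c N" if "N \<in> pverts (AG R M) - {c}" for N
    using that adj[of N] verts_iff[of N] by simp
  show "N = c \<or> K = c" if "N \<in> \<Lambda>" "K \<in> \<Lambda>" "N \<noteq> K \<and> annih N K" for N K
    using that only by simp
qed

lemma star_center:
  assumes "star_graph (AG R M)"
  obtains c where "c \<in> \<Lambda>" "\<And>N K. \<lbrakk>N \<in> \<Lambda>; K \<in> \<Lambda>; N \<noteq> K; annih N K\<rbrakk> \<Longrightarrow> N = c \<or> K = c"
proof -
  from assms[unfolded AG_star_iff] obtain c where c: "c \<in> pverts (AG R M)"
    "\<forall>N \<in> \<Lambda>. \<forall>K \<in> \<Lambda>. N \<noteq> K \<and> annih N K \<longrightarrow> N = c \<or> K = c" by (elim bexE conjE)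
  show thesis
  proof (rule that)
    show "c \<in> \<Lambda>" using c(1)[unfolded verts_iff] by (rule conjunct1)
    show "N = c \<or> K = c" if "N \<in> \<Lambda>" "K \<in> \<Lambda>" "N \<noteq> K" "annih N K" for N K
      using c(2)[rule_format, of N K] that by simp
  qed
qed

text \<open>Three distinct, pairwise adjacent vertices would need a centre lying on all three
  edges.\<close>

lemma star_triangle_free:
  assumes "star_graph (AG R M)" "N \<in> \<Lambda>" "K \<in> \<Lambda>" "L \<in> \<Lambda>"
    and "annih N K" "annih N L" "annih K L" "N \<noteq> K" "N \<noteq> L"
  shows "K = L"
  using assms unfolding AG_star_iff by metis

section \<open>Complementary idempotents and rings that are not local\<close>

text \<open>From ef = 0 it follows that f kills eM, and from e + f = 1 that e is then the identity
  on eM.\<close>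

lemma complementary_images:
  assumes ef: "e \<in> carrier R" "f \<in> carrier R" "e \<oplus> f = \<one>" "e \<otimes> f = \<zero>"
    and y: "y \<in> (\<lambda>x. e \<odot>\<^bsub>M\<^esub> x) ` carrier M"
  shows "f \<odot>\<^bsub>M\<^esub> y = \<zero>\<^bsub>M\<^esub>" "e \<odot>\<^bsub>M\<^esub> y = y"
proof -
  obtain x where x: "x \<in> carrier M" "y = e \<odot>\<^bsub>M\<^esub> x" using y by blast
  have yM: "y \<in> carrier M" using x ef by simp
  show 1: "f \<odot>\<^bsub>M\<^esub> y = \<zero>\<^bsub>M\<^esub>"
    using x ef smult_assoc1[of e f x] smult_lcomm[of f e x] by simp
  have "y = e \<odot>\<^bsub>M\<^esub> y \<oplus>\<^bsub>M\<^esub> f \<odot>\<^bsub>M\<^esub> y"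
    using yM ef smult_l_distr[of e f y] by simp
  then show "e \<odot>\<^bsub>M\<^esub> y = y" using 1 yM ef by simp
qed

lemma complementary_decomposition:
  assumes ef: "e \<in> carrier R" "f \<in> carrier R" "e \<oplus> f = \<one>" and x: "x \<in> carrier M"
  shows "x = e \<odot>\<^bsub>M\<^esub> x \<oplus>\<^bsub>M\<^esub> f \<odot>\<^bsub>M\<^esub> x"
  using x ef smult_l_distr[of e f x] by simp

text \<open>The claim is proved by finding a simple S = Rm inside K and showing S = B. The vertices
  involved are A = fM, B = eM, S and Q = qM with q = (0 : m).\<close>

lemma complementary_summand_simple:
  assumes star: "star_graph (AG R M)"
    and ef: "e \<in> carrier R" "f \<in> carrier R" "e \<oplus> f = \<one>" "e \<otimes> f = \<zero>"
    and B_def: "B = (\<lambda>x. e \<odot>\<^bsub>M\<^esub> x) ` carrier M" and A_def: "A = (\<lambda>x. f \<odot>\<^bsub>M\<^esub> x) ` carrier M"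
    and B0: "B \<noteq> {\<zero>\<^bsub>M\<^esub>}" and A0: "A \<noteq> {\<zero>\<^bsub>M\<^esub>}"
    and K: "submodule K R M" "K \<subseteq> B" "K \<noteq> {\<zero>\<^bsub>M\<^esub>}"
  shows "K = B"
proof -
  have sA: "submodule A R M" and sB: "submodule B R M"
    unfolding A_def B_def using image_submodule carrier_is_submodule ef by blast+
  have fe: "f \<oplus> e = \<one>" "f \<otimes> e = \<zero>" using ef R.a_comm R.m_comm by auto
  note inB = complementary_images[OF ef, folded B_def]
  note inA = complementary_images[OF ef(2,1) fe, folded A_def]
  have AB: "A \<inter> B = {\<zero>\<^bsub>M\<^esub>}"
    using inA(2) inB(1) submodule_zero[OF sA] submodule_zero[OF sB] by force
  have "A \<noteq> carrier M" "B \<noteq> carrier M"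
    using AB A0 B0 submoduleE(1)[OF sA] submoduleE(1)[OF sB] by blast+
  then have A: "A \<in> \<Lambda>" and B: "B \<in> \<Lambda>" using sA sB A0 B0 nonzero_properI by auto
  have ABn: "A \<noteq> B" using AB A0 by blast
  obtain m where mK: "m \<in> K" and simp_m: "simple_elem m"
    using simple_elem_in_submodule[OF K(1,3)] .
  then have mM: "m \<in> carrier M" "m \<noteq> \<zero>\<^bsub>M\<^esub>" by (auto simp: simple_elem_def)
  define S where "S = cyclic_submodule R M m"
  define q where "q = elem_annihilator R M m"
  define Q where "Q = ideal_smult R M q (carrier M)"
  have sS: "submodule S R M" unfolding S_def using cyclic_is_submodule[OF mM(1)] .
  have S0: "S \<noteq> {\<zero>\<^bsub>M\<^esub>}" unfolding S_def using cyclic_nonzero[OF mM] .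
  have SK: "S \<subseteq> K" unfolding S_def using cyclic_subset[OF K(1) mK] .
  then have SB: "S \<subseteq> B" using K(2) by blast
  have AS: "A \<inter> S = {\<zero>\<^bsub>M\<^esub>}" using AB SB submodule_zero[OF sA] submodule_zero[OF sS] by blast
  then have ASn: "A \<noteq> S" using A0 by blast
  have "S \<noteq> carrier M" using SB \<open>B \<noteq> carrier M\<close> submoduleE(1)[OF sB] by blast
  then have S: "S \<in> \<Lambda>" using nonzero_properI[OF sS S0] by blast
  have q: "ideal q R" unfolding q_def using elem_annihilator_ideal[OF mM(1)] .
  have sQ: "submodule Q R M"
    unfolding Q_def using ideal_smult_submodule[OF q] M.zero_closed by blast
  \<comment> \<open>The scalar f kills B and hence m; this puts A = fM inside Q, so that Q is
    nonzero and different from S.\<close>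
  have "f \<in> q" unfolding q_def elem_annihilator_def using inB(1) mK K(2) ef by auto
  then have AQ: "A \<subseteq> Q" unfolding A_def Q_def by (auto intro: ideal_smult.smult)
  have SQ: "annih S Q"
  proof (rule annihI)
    fix r s x assume r: "r \<in> carrier R" and s: "s \<in> carrier R" and x: "x \<in> carrier M"
      and rS: "\<And>y. y \<in> carrier M \<Longrightarrow> r \<odot>\<^bsub>M\<^esub> y \<in> S" and sQ: "\<And>y. y \<in> carrier M \<Longrightarrow> s \<odot>\<^bsub>M\<^esub> y \<in> Q"
    have "Q \<subseteq> {y \<in> carrier M. r \<odot>\<^bsub>M\<^esub> y = \<zero>\<^bsub>M\<^esub>}"
      unfolding Q_def
    proof (rule ideal_smult_least[OF kernel_submodule[OF r]])
      fix a y assume a: "a \<in> q" and y: "y \<in> carrier M"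
      have aR: "a \<in> carrier R" "a \<odot>\<^bsub>M\<^esub> m = \<zero>\<^bsub>M\<^esub>" using a unfolding q_def elem_annihilator_def by auto
      obtain t where t: "t \<in> carrier R" "r \<odot>\<^bsub>M\<^esub> y = t \<odot>\<^bsub>M\<^esub> m"
        using rS[OF y] unfolding S_def cyclic_submodule_def by blast
      have "r \<odot>\<^bsub>M\<^esub> (a \<odot>\<^bsub>M\<^esub> y) = a \<odot>\<^bsub>M\<^esub> (t \<odot>\<^bsub>M\<^esub> m)" using r aR y t smult_lcomm[of r a y] by simp
      also have "\<dots> = \<zero>\<^bsub>M\<^esub>" using aR t(1) mM smult_lcomm[of a t m] by simp
      finally show "a \<odot>\<^bsub>M\<^esub> y \<in> {y \<in> carrier M. r \<odot>\<^bsub>M\<^esub> y = \<zero>\<^bsub>M\<^esub>}" using aR y by simp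
    qed
    then show "r \<odot>\<^bsub>M\<^esub> (s \<odot>\<^bsub>M\<^esub> x) = \<zero>\<^bsub>M\<^esub>" using sQ[OF x] by blast
  qed
  have "S = B"
  proof (cases "Q = A")
    case False
    have "Q \<noteq> S" using AQ AS A0 by blast
    have "Q \<noteq> {\<zero>\<^bsub>M\<^esub>}" using AQ A0 submodule_zero[OF sA] by blast
    moreover have "Q \<noteq> carrier M"
    proof
      assume "Q = carrier M"
      then have "annih (carrier M) S" using SQ annih_commute by simp
      moreover have "carrier M \<noteq> {\<zero>\<^bsub>M\<^esub>}" using mM by blast
      ultimately show False using not_annih_carrier[OF S] by blast
    qed
    ultimately have Q: "Q \<in> \<Lambda>" using nonzero_properI[OF sQ] by blast
    obtain c where c: "\<And>N K. \<lbrakk>N \<in> \<Lambda>; K \<in> \<Lambda>; N \<noteq> K; annih N K\<rbrakk> \<Longrightarrow> N = c \<or> K = c"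
      using star_center[OF star] by metis
    \<comment> \<open>The centre lies on the edges A-B, A-S and S-Q. If S differed from B, the first
      two would make A the centre, and the third would force Q = A.\<close>
    have "A = c \<or> B = c" using c[OF A B ABn annih_if_disjoint[OF sA sB AB]] .
    moreover have "A = c \<or> S = c" using c[OF A S ASn annih_if_disjoint[OF sA sS AS]] .
    moreover have "S = c \<or> Q = c" using c[OF S Q] \<open>Q \<noteq> S\<close> SQ by blast
    ultimately show ?thesis using False ASn by blast
  next
    case True
    \<comment> \<open>Now q kills B, since qB lies in B and in Q = A. The chosen r in (S : M) acts
      nontrivially on B, so it is outside q and some 1 - tr lies in q. Then y = try for y in B,
      which lies in S.\<close>
    obtain r x where r: "r \<in> residual R M S" and x: "x \<in> carrier M" "r \<odot>\<^bsub>M\<^esub> x \<noteq> \<zero>\<^bsub>M\<^esub>"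
      using residual_nonzero[OF S] .
    have rR: "r \<in> carrier R" using residual_carrier[OF r] .
    have key: "u \<odot>\<^bsub>M\<^esub> y = \<zero>\<^bsub>M\<^esub>" if "u \<in> q" "y \<in> B" for u y
    proof -
      have "u \<odot>\<^bsub>M\<^esub> y \<in> B" using submodule_smult[OF sB] that ideal.Icarr[OF q] by blast
      moreover have "u \<odot>\<^bsub>M\<^esub> y \<in> Q"
        unfolding Q_def using that submodule_carrier[OF sB] by (auto intro: ideal_smult.smult)
      ultimately show ?thesis using True AB by blast
    qed
    have "r \<odot>\<^bsub>M\<^esub> x = e \<odot>\<^bsub>M\<^esub> (r \<odot>\<^bsub>M\<^esub> x)" using inB(2) SB residual_smult[OF r x(1)] by force
    also have "\<dots> = r \<odot>\<^bsub>M\<^esub> (e \<odot>\<^bsub>M\<^esub> x)" using smult_lcomm rR ef(1) x(1) by blast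
    finally have "r \<notin> q" using key[of r "e \<odot>\<^bsub>M\<^esub> x"] x unfolding B_def by auto
    then obtain t where t: "t \<in> carrier R" "t \<odot>\<^bsub>M\<^esub> (r \<odot>\<^bsub>M\<^esub> m) = m"
      using simp_m rR unfolding q_def elem_annihilator_def simple_elem_def by blast
    have u: "\<one> \<ominus> t \<otimes> r \<in> q"
      using t rR mM by (simp add: q_def elem_annihilator_def R.minus_eq smult_l_distr smult_l_minus
          smult_assoc1 M.r_neg)
    have "y \<in> S" if y: "y \<in> B" for y
    proof -
      have yM: "y \<in> carrier M" using submodule_carrier[OF sB y] .
      have "(\<one> \<ominus> t \<otimes> r) \<odot>\<^bsub>M\<^esub> y = y \<ominus>\<^bsub>M\<^esub> t \<odot>\<^bsub>M\<^esub> (r \<odot>\<^bsub>M\<^esub> y)"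
        using yM t rR by (simp add: R.minus_eq M.minus_eq smult_l_distr smult_l_minus smult_assoc1)
      then have "y \<ominus>\<^bsub>M\<^esub> t \<odot>\<^bsub>M\<^esub> (r \<odot>\<^bsub>M\<^esub> y) \<in> S"
        using key[OF u y] submodule_zero[OF sS] by simp
      moreover have "t \<odot>\<^bsub>M\<^esub> (r \<odot>\<^bsub>M\<^esub> y) \<in> S"
        using submodule_smult[OF sS t(1)] residual_smult[OF r yM] by blast
      ultimately show ?thesis using submodule_diff_cancel[OF sS yM] by blast
    qed
    then show ?thesis using SB by blast
  qed
  then show ?thesis using SK K(2) by blast
qed

text \<open>A nonzero idempotent is not nilpotent, whereas all elements of Ann(M) are.\<close>

lemma idempotent_not_annihilator:
  assumes e: "e \<in> carrier R" "e \<otimes> e = e" "e \<noteq> \<zero>"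
  obtains x where "x \<in> carrier M" "e \<odot>\<^bsub>M\<^esub> x \<noteq> \<zero>\<^bsub>M\<^esub>"
proof -
  have "e \<notin> annihilator R M"
  proof
    assume "e \<in> annihilator R M"
    then obtain n :: nat where n: "e [^] n = \<zero>" using nil_annihilator unfolding nil_ideal_def by blast
    \<comment> \<open>Comparing with the exponent n + 1 also covers n = 0.\<close>
    have "e [^] Suc k = e" for k :: nat
      by (induction k) (use e in auto)
    then show False using n e by (metis R.nat_pow_Suc R.l_null)
  qed
  then show thesis using that e(1) unfolding annihilator_def residual_def by blast
qed

text \<open>For y in q but not in q', a power w of y with w = zww yields the idempotent zw. It is
  not 1 because it lies in q, and not 0 because w = (zw)w is outside the prime ideal q'.\<close>

lemma nonlocal_idempotent:
  assumes q: "maximalideal q R" and q': "maximalideal q' R" "q \<noteq> q'"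
  obtains e where "e \<in> carrier R" "e \<otimes> e = e" "e \<noteq> \<zero>" "e \<noteq> \<one>"
proof -
  interpret q: maximalideal q R by fact
  interpret q': maximalideal q' R by fact
  interpret p': primeideal q' R using R.maximalideal_prime[OF q'(1)] .
  have "\<not> q \<subseteq> q'"
    using q.I_maximal[OF q'.is_ideal _ q'.a_subset] q'(2) q'.I_notcarr by blast
  then obtain y where y: "y \<in> q" "y \<notin> q'" by blast
  have yR: "y \<in> carrier R" using y(1) by (rule q.Icarr)
  obtain n :: nat and z where z: "z \<in> carrier R" and
    w: "y [^] Suc n = z \<otimes> (y [^] Suc n \<otimes> y [^] Suc n)"
    using power_idempotent[OF R.is_cring yR] by blast
  define w where "w = y [^] Suc n"
  have wR: "w \<in> carrier R" and wz: "w = z \<otimes> (w \<otimes> w)" using yR w by (simp_all add: w_def)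
  have "y [^] k \<notin> q'" for k :: nat
  proof (induction k)
    case 0
    then show ?case using q'.one_imp_carrier q'.I_notcarr by auto
  next
    case (Suc k)
    then show ?case using p'.I_prime[of "y [^] k" y] y(2) yR by auto
  qed
  then have wq': "w \<notin> q'" unfolding w_def by blast
  have wq: "w \<in> q" unfolding w_def using q.I_l_closed[OF y(1)] yR by simp
  show thesis
  proof (rule that[of "z \<otimes> w"])
    show "z \<otimes> w \<in> carrier R" using z wR by simp
    have "(z \<otimes> w) \<otimes> (z \<otimes> w) = z \<otimes> (z \<otimes> (w \<otimes> w))"
      using z wR by (simp add: R.m_assoc R.m_lcomm)
    then show "(z \<otimes> w) \<otimes> (z \<otimes> w) = z \<otimes> w" using wz by simp
    have "w = (z \<otimes> w) \<otimes> w" using wz z wR by (simp add: R.m_assoc)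
    then show "z \<otimes> w \<noteq> \<zero>" using wq' wR q'.zero_closed by (metis R.l_null)
    have "z \<otimes> w \<in> q" using q.I_l_closed[OF wq z] .
    then show "z \<otimes> w \<noteq> \<one>" using q.one_imp_carrier q.I_notcarr by metis
  qed
qed

lemma star_idempotent_direct_sum:
  assumes star: "star_graph (AG R M)"
    and e: "e \<in> carrier R" "e \<otimes> e = e" "e \<noteq> \<zero>" "e \<noteq> \<one>"
  shows "\<exists>M1 M2. direct_sum R M M1 M2 \<and>
    simple_module R (M\<lparr>carrier := M1\<rparr>) \<and> simple_module R (M\<lparr>carrier := M2\<rparr>)"
proof -
  define f where "f = \<one> \<ominus> e"
  have f: "f \<in> carrier R" using e by (simp add: f_def)
  have "f \<oplus> e = \<one>" using e by (simp add: f_def R.minus_eq R.a_assoc R.l_neg)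
  then have ef: "e \<oplus> f = \<one>" using e(1) f R.a_comm by simp
  have ef0: "e \<otimes> f = \<zero>" using e by (simp add: f_def R.minus_eq R.r_distr R.r_minus R.r_neg)
  have fe: "f \<oplus> e = \<one>" "f \<otimes> e = \<zero>" using ef ef0 e(1) f R.a_comm R.m_comm by auto
  have "f \<noteq> \<zero>" using ef e by auto
  have "f \<otimes> f = (e \<oplus> f) \<otimes> f" using e f ef0 by (simp add: R.l_distr)
  then have ff: "f \<otimes> f = f" using ef f by simp
  define A B where "A = (\<lambda>x. f \<odot>\<^bsub>M\<^esub> x) ` carrier M" and "B = (\<lambda>x. e \<odot>\<^bsub>M\<^esub> x) ` carrier M"
  have sA: "submodule A R M" and sB: "submodule B R M"
    unfolding A_def B_def using image_submodule carrier_is_submodule e f by blast+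
  have B0: "B \<noteq> {\<zero>\<^bsub>M\<^esub>}" using idempotent_not_annihilator[OF e(1-3)] unfolding B_def by blast
  have A0: "A \<noteq> {\<zero>\<^bsub>M\<^esub>}"
    using idempotent_not_annihilator[OF f ff \<open>f \<noteq> \<zero>\<close>] unfolding A_def by blast
  have "simple_module R (M\<lparr>carrier := B\<rparr>)" "simple_module R (M\<lparr>carrier := A\<rparr>)"
    unfolding simple_submodule_iff[OF sA] simple_submodule_iff[OF sB]
    using complementary_summand_simple[OF star e(1) f ef ef0 B_def A_def B0 A0]
      complementary_summand_simple[OF star f e(1) fe A_def B_def A0 B0] A0 B0 by blast+
  moreover have "B \<inter> A = {\<zero>\<^bsub>M\<^esub>}"
  proof -
    have "y = \<zero>\<^bsub>M\<^esub>" if "y \<in> B" "y \<in> A" for y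
      using complementary_images(1)[OF e(1) f ef ef0 that(1)[unfolded B_def]]
        complementary_images(2)[OF f e(1) fe that(2)[unfolded A_def]] by simp
    then show ?thesis using submodule_zero[OF sA] submodule_zero[OF sB] by blast
  qed
  moreover have "B <+>\<^bsub>M\<^esub> A = carrier M"
  proof
    show "B <+>\<^bsub>M\<^esub> A \<subseteq> carrier M"
      using submoduleE(1)[OF sA] submoduleE(1)[OF sB] by (auto simp: set_add_def')
    show "carrier M \<subseteq> B <+>\<^bsub>M\<^esub> A"
      using complementary_decomposition[OF e(1) f ef] unfolding set_add_def' A_def B_def by blast
  qed
  ultimately show ?thesis unfolding direct_sum_def using sA sB by blast
qed

text \<open>A star has a vertex, which contains a simple element, and its annihilator is a first
  maximal ideal. A ring that is not local has a second one, and the two give an idempotent.\<close>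

lemma star_local_or_direct_sum:
  assumes star: "star_graph (AG R M)" and no: "\<nexists>p. local_ring_with R p"
  shows "\<exists>M1 M2. direct_sum R M M1 M2 \<and>
    simple_module R (M\<lparr>carrier := M1\<rparr>) \<and> simple_module R (M\<lparr>carrier := M2\<rparr>)"
proof -
  obtain N where "N \<in> \<Lambda>" using star_center[OF star] by metis
  then obtain m where "simple_elem m"
    using simple_elem_in_submodule[OF nonzero_properD(1,2)] by metis
  then have q: "maximalideal (elem_annihilator R M m) R" by (rule simple_elem_annihilator_maximal)
  then obtain q' where "maximalideal q' R" "elem_annihilator R M m \<noteq> q'"
    using no R.is_cring unfolding local_ring_with_def by metis
  then obtain e where "e \<in> carrier R" "e \<otimes> e = e" "e \<noteq> \<zero>" "e \<noteq> \<one>"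
    using nonlocal_idempotent[OF q] by blast
  then show ?thesis by (rule star_idempotent_direct_sum[OF star])
qed

text \<open>The graph is the edge joining M1 and M2. Any further submodule, such as a diagonal one
  when M1 and M2 are isomorphic, is excluded because M is not a vertex.\<close>

lemma direct_sum_star:
  assumes "direct_sum R M M1 M2"
    and "simple_module R (M\<lparr>carrier := M1\<rparr>)" "simple_module R (M\<lparr>carrier := M2\<rparr>)"
  shows "star_graph (AG R M)"
proof -
  have s1: "submodule M1 R M" and s2: "submodule M2 R M" and sum: "M1 <+>\<^bsub>M\<^esub> M2 = carrier M"
    and int: "M1 \<inter> M2 = {\<zero>\<^bsub>M\<^esub>}"
    using assms(1) unfolding direct_sum_def by auto
  have n1: "M1 \<noteq> {\<zero>\<^bsub>M\<^esub>}" and m1: "\<And>K. submodule K R M \<Longrightarrow> K \<subseteq> M1 \<Longrightarrow> K = {\<zero>\<^bsub>M\<^esub>} \<or> K = M1"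
    using assms(2) simple_submodule_iff[OF s1] by auto
  have n2: "M2 \<noteq> {\<zero>\<^bsub>M\<^esub>}" and m2: "\<And>K. submodule K R M \<Longrightarrow> K \<subseteq> M2 \<Longrightarrow> K = {\<zero>\<^bsub>M\<^esub>} \<or> K = M2"
    using assms(3) simple_submodule_iff[OF s2] by auto
  have dec: "\<exists>u \<in> M1. \<exists>v \<in> M2. x = u \<oplus>\<^bsub>M\<^esub> v" if "x \<in> carrier M" for x
    using that unfolding sum[symmetric] set_add_def' by blast
  have L1: "M1 \<in> \<Lambda>" using int n1 n2 nonzero_properI[OF s1] submoduleE(1)[OF s2] by blast
  have L2: "M2 \<in> \<Lambda>" using int n1 n2 nonzero_properI[OF s2] submoduleE(1)[OF s1] by blast
  have sub_int: "submodule (N \<inter> K) R M" if "submodule N R M" "submodule K R M" for N K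
    by (rule submoduleI) (use that submoduleE submodule_zero in auto)
  have only: "N = M1 \<or> N = M2" if NL: "N \<in> \<Lambda>" for N
  proof (rule ccontr)
    assume neg: "\<not> (N = M1 \<or> N = M2)"
    have sN: "submodule N R M" and N0: "N \<noteq> {\<zero>\<^bsub>M\<^esub>}" and NM: "N \<noteq> carrier M"
      using nonzero_properD[OF NL] by auto
    have i1: "N \<inter> M1 = {\<zero>\<^bsub>M\<^esub>} \<or> M1 \<subseteq> N" using m1[OF sub_int[OF sN s1]] by blast
    have i2: "N \<inter> M2 = {\<zero>\<^bsub>M\<^esub>} \<or> M2 \<subseteq> N" using m2[OF sub_int[OF sN s2]] by blast
    have sum_sub: "x \<in> N" if "x \<in> carrier M" "M1 \<subseteq> N" "M2 \<subseteq> N" for x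
      using dec[OF that(1)] that(2,3) submodule_add[OF sN] by blast
    have cancel: "v \<in> N" if "u \<oplus>\<^bsub>M\<^esub> v \<in> N" "u \<in> N" "v \<in> carrier M" for u v
    proof -
      have "(v \<oplus>\<^bsub>M\<^esub> u) \<ominus>\<^bsub>M\<^esub> u = v"
        using that(3) submodule_carrier[OF sN that(2)] by (simp add: M.minus_eq M.a_assoc M.r_neg)
      then have "v = (u \<oplus>\<^bsub>M\<^esub> v) \<ominus>\<^bsub>M\<^esub> u"
        using that(3) submodule_carrier[OF sN that(2)] M.a_comm by simp
      then show ?thesis using submodule_diff[OF sN that(1,2)] by simp
    qed
    \<comment> \<open>A proper N that contains M1 meets M2 in zero, so the M2-components of its
      elements vanish and N = M1.\<close>
    have c1: "\<not> M1 \<subseteq> N"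
    proof
      assume 1: "M1 \<subseteq> N"
      then have "N \<inter> M2 = {\<zero>\<^bsub>M\<^esub>}" using i2 sum_sub NM submoduleE(1)[OF sN] by blast
      have "N \<subseteq> M1"
      proof
        fix x assume x: "x \<in> N"
        then obtain u v where uv: "u \<in> M1" "v \<in> M2" "x = u \<oplus>\<^bsub>M\<^esub> v"
          using dec submodule_carrier[OF sN] by blast
        then have "v \<in> N" using cancel[of u v] x 1 submodule_carrier[OF s2] by blast
        then have "v = \<zero>\<^bsub>M\<^esub>" using \<open>N \<inter> M2 = {\<zero>\<^bsub>M\<^esub>}\<close> uv by blast
        then show "x \<in> M1" using uv submodule_carrier[OF s1] by simp
      qed
      then show False using 1 neg by blast
    qed
    have c2: "\<not> M2 \<subseteq> N"
    proof
      assume 2: "M2 \<subseteq> N"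
      then have "N \<inter> M1 = {\<zero>\<^bsub>M\<^esub>}" using i1 sum_sub NM submoduleE(1)[OF sN] by blast
      have "N \<subseteq> M2"
      proof
        fix x assume x: "x \<in> N"
        then obtain u v where uv: "u \<in> M1" "v \<in> M2" "x = u \<oplus>\<^bsub>M\<^esub> v"
          using dec submodule_carrier[OF sN] by blast
        then have vu: "x = v \<oplus>\<^bsub>M\<^esub> u"
          using M.a_comm submodule_carrier[OF s1] submodule_carrier[OF s2] by simp
        then have "u \<in> N" using cancel[of v u] x 2 uv submodule_carrier[OF s1] by blast
        then have "u = \<zero>\<^bsub>M\<^esub>" using \<open>N \<inter> M1 = {\<zero>\<^bsub>M\<^esub>}\<close> uv by blast
        then show "x \<in> M2" using uv submodule_carrier[OF s2] by simp
      qed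
      then show False using 2 neg by blast
    qed
    \<comment> \<open>As N meets M1 and M2 in zero only, (N : M) kills both summands and hence M,
      against \<open>residual_nonzero\<close>.\<close>
    obtain r x where r: "r \<in> residual R M N" and x: "x \<in> carrier M" "r \<odot>\<^bsub>M\<^esub> x \<noteq> \<zero>\<^bsub>M\<^esub>"
      using residual_nonzero[OF NL] .
    have rR: "r \<in> carrier R" using residual_carrier[OF r] .
    obtain u v where uv: "u \<in> M1" "v \<in> M2" "x = u \<oplus>\<^bsub>M\<^esub> v" using dec[OF x(1)] by blast
    have uM: "u \<in> carrier M" and vM: "v \<in> carrier M"
      using uv submodule_carrier[OF s1] submodule_carrier[OF s2] by auto
    have "r \<odot>\<^bsub>M\<^esub> u \<in> N \<inter> M1" "r \<odot>\<^bsub>M\<^esub> v \<in> N \<inter> M2"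
      using residual_smult[OF r] uM vM uv submodule_smult[OF s1 rR] submodule_smult[OF s2 rR] by auto
    then have "r \<odot>\<^bsub>M\<^esub> u = \<zero>\<^bsub>M\<^esub>" "r \<odot>\<^bsub>M\<^esub> v = \<zero>\<^bsub>M\<^esub>" using i1 i2 c1 c2 by blast+
    then show False using x uv uM vM rR by (simp add: smult_r_distr)
  qed
  have an: "annih M1 M2" using annih_if_disjoint[OF s1 s2 int] .
  show ?thesis
  proof (rule star_graphI[OF L1 L2 an])
    show "annih M1 N" if "N \<in> \<Lambda>" "N \<noteq> M1" for N using only[OF that(1)] that(2) an by blast
    show "N = M1 \<or> K = M1" if "N \<in> \<Lambda>" "K \<in> \<Lambda>" "N \<noteq> K" for N K
      using only[OF that(1)] only[OF that(2)] that(3) by blast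
  qed
qed

end

section \<open>Local rings\<close>

locale local_artinian_module = nonvertex_artinian_module +
  fixes p
  assumes local_ring: "local_ring_with R p"
begin

section \<open>The submodules p^n M\<close>

definition pM where "pM n = ideal_smult R M (ideal_power R p n) (carrier M)"

lemma p_maximal: "maximalideal p R"
  using local_ring unfolding local_ring_with_def by blast

lemma p_ideal: "ideal p R"
  using maximalideal.axioms(1)[OF p_maximal] .

lemma p_carrier: "a \<in> p \<Longrightarrow> a \<in> carrier R"
  by (rule ideal.Icarr[OF p_ideal])

lemma pM_0: "pM 0 = carrier M"
  unfolding pM_def by (rule ideal_smult_power_0)

lemma pM_Suc: "pM (Suc n) = ideal_smult R M p (pM n)"
  unfolding pM_def by (rule ideal_smult_power_Suc[OF p_ideal])

lemma pM_submodule: "submodule (pM n) R M"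
  unfolding pM_def
  using ideal_smult_submodule[OF ideal_power_ideal[OF p_ideal]] M.zero_closed by blast

lemma pM_smult: "\<lbrakk>a \<in> p; x \<in> pM n\<rbrakk> \<Longrightarrow> a \<odot>\<^bsub>M\<^esub> x \<in> pM (Suc n)"
  unfolding pM_Suc by (rule ideal_smult.smult)

lemma pM_least:
  "\<lbrakk>submodule K R M; \<And>a x. \<lbrakk>a \<in> p; x \<in> pM n\<rbrakk> \<Longrightarrow> a \<odot>\<^bsub>M\<^esub> x \<in> K\<rbrakk> \<Longrightarrow> pM (Suc n) \<subseteq> K"
  unfolding pM_Suc by (rule ideal_smult_least)

lemma pM_decreasing: "pM (Suc n) \<subseteq> pM n"
  by (rule pM_least[OF pM_submodule]) (use submodule_smult[OF pM_submodule] p_carrier in blast)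

lemma pM2I: "\<lbrakk>a \<in> p; b \<in> p; x \<in> carrier M\<rbrakk> \<Longrightarrow> a \<odot>\<^bsub>M\<^esub> (b \<odot>\<^bsub>M\<^esub> x) \<in> pM 2"
  using pM_smult[of a "b \<odot>\<^bsub>M\<^esub> x" 1] pM_smult[of b x 0] by (simp add: pM_0 numeral_2_eq_2)

text \<open>The elements abx with a, b in p generate p^2M; applying a to pM is handled by a preimage
  submodule.\<close>

lemma pM2_least:
  assumes "submodule K R M" "\<And>a b x. \<lbrakk>a \<in> p; b \<in> p; x \<in> carrier M\<rbrakk> \<Longrightarrow> a \<odot>\<^bsub>M\<^esub> (b \<odot>\<^bsub>M\<^esub> x) \<in> K"
  shows "pM 2 \<subseteq> K"
proof -
  have "pM (Suc 1) \<subseteq> K"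
  proof (rule pM_least[OF assms(1)])
    fix a y assume a: "a \<in> p" and y: "y \<in> pM 1"
    have "pM (Suc 0) \<subseteq> {y \<in> carrier M. a \<odot>\<^bsub>M\<^esub> y \<in> K}"
      by (rule pM_least[OF preimage_submodule[OF p_carrier[OF a] assms(1)]])
        (use assms(2)[OF a] p_carrier pM_0 in simp)
    then show "a \<odot>\<^bsub>M\<^esub> y \<in> K" using y by auto
  qed
  then show ?thesis by (simp add: numeral_2_eq_2)
qed

lemma pM_fixed: "pM (Suc n) = pM n \<Longrightarrow> pM (n + k) = pM n"
  by (induction k) (simp_all add: pM_Suc)

lemma simple_elem_annihilator:
  assumes "simple_elem m"
  shows "elem_annihilator R M m = p"
  using simple_elem_annihilator_maximal[OF assms] local_ring unfolding local_ring_with_def by blast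

section \<open>Simple elements and substitutes for Nakayama's lemma\<close>

text \<open>A nonzero x would have a simple multiple rx. It is killed by u, as p is its annihilator,
  yet u fixes it along with x.\<close>

lemma fixed_by_p_zero:
  assumes u: "u \<in> p" and x: "x \<in> carrier M" and ux: "u \<odot>\<^bsub>M\<^esub> x = x"
  shows "x = \<zero>\<^bsub>M\<^esub>"
proof (rule ccontr)
  assume "x \<noteq> \<zero>\<^bsub>M\<^esub>"
  then obtain r where r: "r \<in> carrier R" "simple_elem (r \<odot>\<^bsub>M\<^esub> x)"
    using simple_elem_exists[OF x] by metis
  then have "u \<odot>\<^bsub>M\<^esub> (r \<odot>\<^bsub>M\<^esub> x) = \<zero>\<^bsub>M\<^esub>"
    using simple_elem_annihilator[OF r(2)] u unfolding elem_annihilator_def by blast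
  moreover have "u \<odot>\<^bsub>M\<^esub> (r \<odot>\<^bsub>M\<^esub> x) = r \<odot>\<^bsub>M\<^esub> x"
    using smult_lcomm[OF p_carrier[OF u] r(1) x] ux by simp
  ultimately show False using r(2) unfolding simple_elem_def by simp
qed

text \<open>By maximality p + Rr is the whole ring; the decomposition 1 = a + sr is recorded through
  its action on M.\<close>

lemma unit_mod_p:
  assumes r: "r \<in> carrier R" "r \<notin> p"
  obtains a s where "a \<in> p" "s \<in> carrier R" "\<And>y. y \<in> carrier M \<Longrightarrow> y = a \<odot>\<^bsub>M\<^esub> y \<oplus>\<^bsub>M\<^esub> s \<odot>\<^bsub>M\<^esub> (r \<odot>\<^bsub>M\<^esub> y)"
proof -
  let ?J = "p <+>\<^bsub>R\<^esub> PIdl r"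
  have Jr: "ideal (PIdl r) R" using R.cgenideal_ideal[OF r(1)] .
  have J: "ideal ?J R" using R.add_ideals[OF p_ideal Jr] .
  have mem: "a \<oplus> b \<in> ?J" if "a \<in> p" "b \<in> PIdl r" for a b
    using that unfolding set_add_def' by blast
  have z: "\<zero> \<in> p" "\<zero> \<in> PIdl r"
    using p_ideal Jr additive_subgroup.zero_closed ideal.axioms(1) by blast+
  have "p \<subseteq> ?J"
  proof
    fix a assume "a \<in> p"
    then show "a \<in> ?J" using mem[OF _ z(2), of a] p_carrier by simp
  qed
  moreover have "r \<in> ?J" using mem[OF z(1) R.cgenideal_self[OF r(1)]] r by simp
  moreover have "?J \<subseteq> carrier R" using ideal.Icarr[OF J] by blast
  ultimately have "?J = carrier R" using maximalideal.I_maximal[OF p_maximal J] r(2) by blast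
  then have "\<one> \<in> ?J" by simp
  then obtain a b where "a \<in> p" "b \<in> PIdl r" "\<one> = a \<oplus> b" unfolding set_add_def' by blast
  moreover from this(2) obtain s where "s \<in> carrier R" "b = s \<otimes> r" unfolding cgenideal_def by blast
  ultimately have as: "a \<in> p" "s \<in> carrier R" "\<one> = a \<oplus> s \<otimes> r" by auto
  show thesis
  proof (rule that[OF as(1,2)])
    fix y assume y: "y \<in> carrier M"
    have "y = (a \<oplus> s \<otimes> r) \<odot>\<^bsub>M\<^esub> y" using y by (simp flip: as(3))
    then show "y = a \<odot>\<^bsub>M\<^esub> y \<oplus>\<^bsub>M\<^esub> s \<odot>\<^bsub>M\<^esub> (r \<odot>\<^bsub>M\<^esub> y)"
      using y r as p_carrier by (simp add: smult_l_distr smult_assoc1)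
  qed
qed

text \<open>For a submodule K distinct from M this gives a nonzero element of M/K killed by p. A
  minimal multiple y of v outside K works: if ay were outside K, then y = tay with ta in p, so y =
  0.\<close>

lemma nakayama_minimal:
  assumes v: "v \<in> carrier M" "v \<notin> K" and K: "\<zero>\<^bsub>M\<^esub> \<in> K"
  obtains y where "y \<in> carrier M" "y \<notin> K" "\<And>a. a \<in> p \<Longrightarrow> a \<odot>\<^bsub>M\<^esub> y \<in> K"
proof -
  obtain r where r: "r \<in> carrier R" "r \<odot>\<^bsub>M\<^esub> v \<notin> K"
    "\<And>s. s \<in> carrier R \<Longrightarrow> s \<odot>\<^bsub>M\<^esub> (r \<odot>\<^bsub>M\<^esub> v) \<in> K \<or>
       (\<exists>t \<in> carrier R. t \<odot>\<^bsub>M\<^esub> (s \<odot>\<^bsub>M\<^esub> (r \<odot>\<^bsub>M\<^esub> v)) = r \<odot>\<^bsub>M\<^esub> v)"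
    using minimal_multiple[OF v] by metis
  show thesis
  proof (rule that[of "r \<odot>\<^bsub>M\<^esub> v"])
    fix a assume a: "a \<in> p"
    have aR: "a \<in> carrier R" using p_carrier[OF a] .
    have y: "r \<odot>\<^bsub>M\<^esub> v \<in> carrier M" using r v by simp
    show "a \<odot>\<^bsub>M\<^esub> (r \<odot>\<^bsub>M\<^esub> v) \<in> K"
    proof (rule ccontr)
      assume "a \<odot>\<^bsub>M\<^esub> (r \<odot>\<^bsub>M\<^esub> v) \<notin> K"
      then obtain t where t: "t \<in> carrier R" "t \<odot>\<^bsub>M\<^esub> (a \<odot>\<^bsub>M\<^esub> (r \<odot>\<^bsub>M\<^esub> v)) = r \<odot>\<^bsub>M\<^esub> v"
        using r(3)[OF aR] by blast
      then have "(t \<otimes> a) \<odot>\<^bsub>M\<^esub> (r \<odot>\<^bsub>M\<^esub> v) = r \<odot>\<^bsub>M\<^esub> v" using aR y by (simp add: smult_assoc1)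
      then have "r \<odot>\<^bsub>M\<^esub> v = \<zero>\<^bsub>M\<^esub>"
        using fixed_by_p_zero[OF ideal.I_l_closed[OF p_ideal a t(1)] y] by blast
      then show False using r(2) K by simp
    qed
  qed (use r v in auto)
qed

text \<open>Take y outside N with py inside N. For r in (N : M) outside p, the decomposition y = ay
  + sry would put y into N.\<close>

lemma residual_subset_p:
  assumes N: "submodule N R M" "N \<noteq> carrier M"
  shows "residual R M N \<subseteq> p"
proof
  fix r assume r: "r \<in> residual R M N"
  show "r \<in> p"
  proof (rule ccontr)
    assume "r \<notin> p"
    then obtain a s where as: "a \<in> p" "s \<in> carrier R"
      "\<And>y. y \<in> carrier M \<Longrightarrow> y = a \<odot>\<^bsub>M\<^esub> y \<oplus>\<^bsub>M\<^esub> s \<odot>\<^bsub>M\<^esub> (r \<odot>\<^bsub>M\<^esub> y)"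
      using unit_mod_p[OF residual_carrier[OF r]] by metis
    obtain v where v: "v \<in> carrier M" "v \<notin> N" using N submoduleE(1)[OF N(1)] by blast
    obtain y where y: "y \<in> carrier M" "y \<notin> N" "\<And>a. a \<in> p \<Longrightarrow> a \<odot>\<^bsub>M\<^esub> y \<in> N"
      using nakayama_minimal[OF v submodule_zero[OF N(1)]] by metis
    have "a \<odot>\<^bsub>M\<^esub> y \<oplus>\<^bsub>M\<^esub> s \<odot>\<^bsub>M\<^esub> (r \<odot>\<^bsub>M\<^esub> y) \<in> N"
      using submodule_add[OF N(1) y(3)[OF as(1)]] submodule_smult[OF N(1) as(2)]
        residual_smult[OF r y(1)] by blast
    then show False using as(3)[OF y(1)] y(2) by simp
  qed
qed

lemma residual_eq_p:
  assumes "submodule N R M" "N \<noteq> carrier M" "pM 1 \<subseteq> N"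
  shows "residual R M N = p"
proof
  show "p \<subseteq> residual R M N"
    using assms(3) pM_smult[of _ _ 0] p_carrier unfolding residual_def pM_0 by auto
qed (rule residual_subset_p[OF assms(1,2)])

text \<open>Scalars outside p are invertible modulo p, and p acts on m as zero.\<close>

lemma simple_elem_if_killed:
  assumes m: "m \<in> carrier M" "m \<noteq> \<zero>\<^bsub>M\<^esub>" "\<And>a. a \<in> p \<Longrightarrow> a \<odot>\<^bsub>M\<^esub> m = \<zero>\<^bsub>M\<^esub>"
  shows "simple_elem m"
  unfolding simple_elem_def
proof (intro conjI ballI m(1,2))
  fix r assume r: "r \<in> carrier R"
  show "r \<odot>\<^bsub>M\<^esub> m = \<zero>\<^bsub>M\<^esub> \<or> (\<exists>t \<in> carrier R. t \<odot>\<^bsub>M\<^esub> (r \<odot>\<^bsub>M\<^esub> m) = m)"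
  proof (cases "r \<in> p")
    case True then show ?thesis using m(3) by simp
  next
    case False
    then obtain a s where "a \<in> p" "s \<in> carrier R" "m = a \<odot>\<^bsub>M\<^esub> m \<oplus>\<^bsub>M\<^esub> s \<odot>\<^bsub>M\<^esub> (r \<odot>\<^bsub>M\<^esub> m)"
      using unit_mod_p[OF r] m(1) by metis
    then have "s \<in> carrier R" "s \<odot>\<^bsub>M\<^esub> (r \<odot>\<^bsub>M\<^esub> m) = m" using m r by auto
    then show ?thesis by blast
  qed
qed

lemma simple_elem_killed:
  assumes "simple_elem m" "a \<in> p" "x \<in> cyclic_submodule R M m"
  shows "a \<odot>\<^bsub>M\<^esub> x = \<zero>\<^bsub>M\<^esub>"
proof -
  have m: "m \<in> carrier M" using assms(1) by (simp add: simple_elem_def)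
  have am: "a \<odot>\<^bsub>M\<^esub> m = \<zero>\<^bsub>M\<^esub>"
    using simple_elem_annihilator[OF assms(1)] assms(2) unfolding elem_annihilator_def by blast
  obtain r where "r \<in> carrier R" "x = r \<odot>\<^bsub>M\<^esub> m"
    using assms(3) unfolding cyclic_submodule_def by blast
  then show ?thesis using am smult_lcomm[OF p_carrier[OF assms(2)] _ m] by simp
qed

text \<open>The ideal (N : M) is contained in p, and p kills Rm.\<close>

lemma annih_simple:
  assumes "simple_elem m" "submodule N R M" "N \<noteq> carrier M"
  shows "annih (cyclic_submodule R M m) N"
proof -
  have "annih N (cyclic_submodule R M m)"
  proof (rule annihI_right)
    fix r y assume "r \<in> residual R M N" "y \<in> cyclic_submodule R M m"
    then show "r \<odot>\<^bsub>M\<^esub> y = \<zero>\<^bsub>M\<^esub>"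
      using simple_elem_killed[OF assms(1)] residual_subset_p[OF assms(2,3)] by blast
  qed
  then show ?thesis using annih_commute by simp
qed

text \<open>The nonzero submodule (N : M)M lies both in N and, since (N : M) is contained in p, in
  pM.\<close>

lemma pM1_not_zero:
  assumes "N \<in> \<Lambda>"
  obtains y where "y \<in> N" "y \<in> pM 1" "y \<noteq> \<zero>\<^bsub>M\<^esub>"
proof -
  obtain r x where rx: "r \<in> residual R M N" "x \<in> carrier M" "r \<odot>\<^bsub>M\<^esub> x \<noteq> \<zero>\<^bsub>M\<^esub>"
    using residual_nonzero[OF assms] .
  then have "r \<in> p" using residual_subset_p nonzero_properD[OF assms] by blast
  then have "r \<odot>\<^bsub>M\<^esub> x \<in> pM 1" using pM_smult[of r x 0] rx(2) pM_0 by simp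
  then show thesis using that[of "r \<odot>\<^bsub>M\<^esub> x"] rx residual_smult[OF rx(1,2)] by blast
qed

text \<open>For a simple S, the ideal (S : M) maps M into S, which p kills; so (S : M) kills pM. If
  pM = M, this contradicts \<open>residual_nonzero\<close>.\<close>

lemma pM1_not_carrier:
  assumes "\<Lambda> \<noteq> {}"
  shows "pM 1 \<noteq> carrier M"
proof
  assume p1: "pM 1 = carrier M"
  obtain N where N: "N \<in> \<Lambda>" using assms by blast
  obtain m where m: "m \<in> N" "simple_elem m"
    using simple_elem_in_submodule[OF nonzero_properD(1,2)[OF N]] .
  let ?S = "cyclic_submodule R M m"
  have mM: "m \<in> carrier M" "m \<noteq> \<zero>\<^bsub>M\<^esub>" using m(2) by (auto simp: simple_elem_def)
  have "?S \<subseteq> N" using cyclic_subset[OF nonzero_properD(1)[OF N] m(1)] .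
  then have "?S \<noteq> carrier M"
    using nonzero_properD[OF N] submoduleE(1)[OF nonzero_properD(1)[OF N]] by blast
  then have S: "?S \<in> \<Lambda>"
    using nonzero_properI[OF cyclic_is_submodule cyclic_nonzero] mM by blast
  obtain r x where rx: "r \<in> residual R M ?S" "x \<in> carrier M" "r \<odot>\<^bsub>M\<^esub> x \<noteq> \<zero>\<^bsub>M\<^esub>"
    using residual_nonzero[OF S] .
  have rR: "r \<in> carrier R" using residual_carrier[OF rx(1)] .
  have "pM (Suc 0) \<subseteq> {x \<in> carrier M. r \<odot>\<^bsub>M\<^esub> x = \<zero>\<^bsub>M\<^esub>}"
  proof (rule pM_least[OF kernel_submodule[OF rR]])
    fix a y assume a: "a \<in> p" and "y \<in> pM 0"
    then have y: "y \<in> carrier M" by (simp add: pM_0)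
    have "r \<odot>\<^bsub>M\<^esub> (a \<odot>\<^bsub>M\<^esub> y) = \<zero>\<^bsub>M\<^esub>"
      using smult_lcomm[OF rR p_carrier[OF a] y] simple_elem_killed[OF m(2) a residual_smult[OF rx(1) y]]
      by simp
    then show "a \<odot>\<^bsub>M\<^esub> y \<in> {x \<in> carrier M. r \<odot>\<^bsub>M\<^esub> x = \<zero>\<^bsub>M\<^esub>}" using y p_carrier[OF a] by simp
  qed
  then show False using p1 rx by auto
qed

end

section \<open>A star over a local ring, with a simple submodule S = Rm\<close>

locale local_star = local_artinian_module +
  fixes m
  assumes star: "star_graph (AG R M)"
    and simple: "simple_elem m"
    and proper: "cyclic_submodule R M m \<noteq> carrier M"
begin

definition S where "S = cyclic_submodule R M m"

lemma m_carrier: "m \<in> carrier M" and m_nonzero: "m \<noteq> \<zero>\<^bsub>M\<^esub>"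
  using simple by (auto simp: simple_elem_def)

lemma S_submodule: "submodule S R M"
  unfolding S_def by (rule cyclic_is_submodule[OF m_carrier])

lemma S_vertex: "S \<in> \<Lambda>"
  using nonzero_properI[OF S_submodule] cyclic_nonzero[OF m_carrier m_nonzero] proper
  unfolding S_def by blast

lemma S_killed: "\<lbrakk>a \<in> p; x \<in> S\<rbrakk> \<Longrightarrow> a \<odot>\<^bsub>M\<^esub> x = \<zero>\<^bsub>M\<^esub>"
  unfolding S_def by (rule simple_elem_killed[OF simple])

lemma S_annih: "N \<in> \<Lambda> \<Longrightarrow> annih S N"
  unfolding S_def using annih_simple[OF simple] nonzero_properD by blast

lemma S_minimal: "\<lbrakk>submodule N R M; x \<in> N; x \<in> S; x \<noteq> \<zero>\<^bsub>M\<^esub>\<rbrakk> \<Longrightarrow> S \<subseteq> N"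
  unfolding S_def by (rule simple_elem_cyclic_subset[OF simple])

text \<open>As \<open>S\<close> is adjacent to every other vertex, there is no edge avoiding \<open>S\<close>.\<close>

lemma no_edge:
  assumes "N \<in> \<Lambda>" "K \<in> \<Lambda>" "N \<noteq> S" "K \<noteq> S" "annih N K"
  shows "N = K"
  using star_triangle_free[OF star S_vertex assms(1,2) S_annih S_annih assms(5)] assms by metis

lemma pM1_proper: "pM 1 \<noteq> carrier M"
  using pM1_not_carrier S_vertex by blast

lemma S_subset_pM1: "S \<subseteq> pM 1"
proof -
  obtain y where "y \<in> S" "y \<in> pM 1" "y \<noteq> \<zero>\<^bsub>M\<^esub>" using pM1_not_zero[OF S_vertex] .
  then show ?thesis using S_minimal[OF pM_submodule] by blast
qed

lemma S_nonzero: "S \<noteq> {\<zero>\<^bsub>M\<^esub>}"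
  using nonzero_properD(2)[OF S_vertex] .

lemma nonzero_if_S_subset: "S \<subseteq> N \<Longrightarrow> N \<noteq> {\<zero>\<^bsub>M\<^esub>}"
  using S_nonzero submodule_zero[OF S_submodule] by blast

lemma pM_not_carrier: "pM (Suc n) \<noteq> carrier M"
proof -
  have "pM (Suc n) \<subseteq> pM 1"
    by (induction n) (use pM_decreasing in auto)
  then show ?thesis using pM1_proper submoduleE(1)[OF pM_submodule[of 1]] by blast
qed

lemma pM1_vertex: "pM 1 \<in> \<Lambda>"
  using nonzero_properI[OF pM_submodule nonzero_if_S_subset[OF S_subset_pM1] pM1_proper] .

lemma residual_p: "N \<in> \<Lambda> \<Longrightarrow> residual R M N \<subseteq> p"
  using residual_subset_p nonzero_properD by blast

lemma vertex_if_subset: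
  "\<lbrakk>N \<in> \<Lambda>; K \<subseteq> N; submodule K R M; K \<noteq> {\<zero>\<^bsub>M\<^esub>}\<rbrakk> \<Longrightarrow> K \<in> \<Lambda>"
  using nonzero_properI nonzero_properD submoduleE(1) by blast

text \<open>Every vertex contains S because it meets pM = S, and all products vanish because p^2M =
  0. Hence at most one vertex N differs from S, and such an N is refuted.\<close>

lemma case_a:
  assumes p1: "pM 1 = S"
  shows "pM 2 = {\<zero>\<^bsub>M\<^esub>}" "\<Lambda> = {S}"
proof -
  have "pM (Suc 1) \<subseteq> {\<zero>\<^bsub>M\<^esub>}"
    by (rule pM_least[OF zero_submodule]) (use p1 S_killed in auto)
  then show "pM 2 = {\<zero>\<^bsub>M\<^esub>}"
    using submodule_zero[OF pM_submodule[of 2]] by (auto simp: numeral_2_eq_2)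
  have SN: "S \<subseteq> N" if N: "N \<in> \<Lambda>" for N
  proof -
    obtain y where "y \<in> N" "y \<in> pM 1" "y \<noteq> \<zero>\<^bsub>M\<^esub>" using pM1_not_zero[OF N] .
    then show ?thesis using S_minimal[OF nonzero_properD(1)[OF N]] p1 by blast
  qed
  have ann: "annih N K" if "N \<in> \<Lambda>" "K \<in> \<Lambda>" for N K
  proof -
    have "r \<odot>\<^bsub>M\<^esub> (s \<odot>\<^bsub>M\<^esub> x) = \<zero>\<^bsub>M\<^esub>"
      if "r \<in> residual R M N" "s \<in> residual R M K" "x \<in> carrier M" for r s x
    proof -
      have "r \<in> p" "s \<in> p" using that residual_p \<open>N \<in> \<Lambda>\<close> \<open>K \<in> \<Lambda>\<close> by blast+
      then show ?thesis using S_killed pM_smult[of s x 0] that(3) p1 pM_0 by simp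
    qed
    then show ?thesis unfolding annih_def by blast
  qed
  have "N = S" if N: "N \<in> \<Lambda>" for N
  proof (rule ccontr)
    assume NS: "N \<noteq> S"
    have sN: "submodule N R M" using nonzero_properD(1)[OF N] .
    have two: "K = N" if "K \<in> \<Lambda>" "K \<noteq> S" for K
      using no_edge[OF that(1) N that(2) NS ann[OF that(1) N]] .
    obtain y where y: "y \<in> N" "y \<notin> S" using NS SN[OF N] by blast
    have yM: "y \<in> carrier M" "y \<noteq> \<zero>\<^bsub>M\<^esub>"
      using y submodule_carrier[OF sN] submodule_zero[OF S_submodule] by auto
    \<comment> \<open>Rx is neither N nor S, since x is outside N and N contains S; by uniqueness of
      N it must be all of M.\<close>
    obtain x where x: "x \<in> carrier M" "x \<notin> N"
      using nonzero_properD(3)[OF N] submoduleE(1)[OF sN] by blast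
    let ?X = "cyclic_submodule R M x"
    have "?X \<noteq> N" "?X \<noteq> S" using cyclic_self[OF x(1)] x(2) SN[OF N] by auto
    then have "?X \<notin> \<Lambda>" using two by blast
    moreover have "x \<noteq> \<zero>\<^bsub>M\<^esub>" using x(2) submodule_zero[OF sN] by blast
    ultimately have "?X = carrier M"
      using nonzero_properI[OF cyclic_is_submodule[OF x(1)] cyclic_nonzero[OF x(1)]] by blast
    then obtain b where b: "b \<in> carrier R" "y = b \<odot>\<^bsub>M\<^esub> x"
      using yM(1) unfolding cyclic_submodule_def by blast
    \<comment> \<open>From y = bx outside S = pM, b is invertible modulo p, and x = ax + sbx lands
      in N: ax lies in S, and sbx = sy in N.\<close>
    have "b \<notin> p" using b(2) y(2) pM_smult[of b x 0] x(1) p1 pM_0 by auto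
    then obtain a s where as: "a \<in> p" "s \<in> carrier R"
      "\<And>y. y \<in> carrier M \<Longrightarrow> y = a \<odot>\<^bsub>M\<^esub> y \<oplus>\<^bsub>M\<^esub> s \<odot>\<^bsub>M\<^esub> (b \<odot>\<^bsub>M\<^esub> y)"
      using unit_mod_p[OF b(1)] by metis
    have "a \<odot>\<^bsub>M\<^esub> x \<in> N" using pM_smult[of a x 0] as(1) x(1) p1 pM_0 SN[OF N] by auto
    moreover have "s \<odot>\<^bsub>M\<^esub> (b \<odot>\<^bsub>M\<^esub> x) \<in> N" using submodule_smult[OF sN as(2) y(1)] b(2) by simp
    ultimately have "a \<odot>\<^bsub>M\<^esub> x \<oplus>\<^bsub>M\<^esub> s \<odot>\<^bsub>M\<^esub> (b \<odot>\<^bsub>M\<^esub> x) \<in> N" by (rule submodule_add[OF sN])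
    then show False using as(3)[OF x(1)] x(2) by simp
  qed
  then show "\<Lambda> = {S}" using S_vertex by blast
qed

text \<open>If p^2M = 0, every nonzero y in pM is simple. For y outside S, Ry annihilates pM, so Ry
  = pM contains m; then the simple Ry is inside S.\<close>

lemma pM2_nonzero:
  assumes p1: "pM 1 \<noteq> S"
  shows "pM 2 \<noteq> {\<zero>\<^bsub>M\<^esub>}"
proof
  assume p2: "pM 2 = {\<zero>\<^bsub>M\<^esub>}"
  have kill: "a \<odot>\<^bsub>M\<^esub> x = \<zero>\<^bsub>M\<^esub>" if "a \<in> p" "x \<in> pM 1" for a x
    using pM_smult[OF that] p2 by (simp add: numeral_2_eq_2)
  obtain y where y: "y \<in> pM 1" "y \<notin> S" using p1 S_subset_pM1 by blast
  have yM: "y \<in> carrier M" "y \<noteq> \<zero>\<^bsub>M\<^esub>"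
    using y submodule_carrier[OF pM_submodule] submodule_zero[OF S_submodule] by auto
  have sy: "simple_elem y" using simple_elem_if_killed[OF yM] kill y(1) by blast
  let ?Y = "cyclic_submodule R M y"
  have sub: "?Y \<subseteq> pM 1" using cyclic_subset[OF pM_submodule y(1)] .
  have Y: "?Y \<in> \<Lambda>"
    using vertex_if_subset[OF pM1_vertex sub cyclic_is_submodule cyclic_nonzero] yM by blast
  have "?Y \<noteq> S" using cyclic_self[OF yM(1)] y(2) by blast
  moreover have "annih ?Y (pM 1)" using annih_simple[OF sy pM_submodule pM1_proper] .
  ultimately have "?Y = pM 1" using no_edge[OF Y pM1_vertex] p1 by blast
  then have "m \<in> ?Y" using S_subset_pM1 cyclic_self[OF m_carrier] unfolding S_def by blast
  then have "?Y \<subseteq> S" using simple_elem_cyclic_subset[OF sy S_submodule _ _ m_nonzero]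
      cyclic_self[OF m_carrier] unfolding S_def by blast
  then show False using cyclic_self[OF yM(1)] y(2) by blast
qed

lemma pM_Suc_zero: "(\<And>a x. \<lbrakk>a \<in> p; x \<in> pM n\<rbrakk> \<Longrightarrow> a \<odot>\<^bsub>M\<^esub> x = \<zero>\<^bsub>M\<^esub>) \<Longrightarrow> pM (Suc n) = {\<zero>\<^bsub>M\<^esub>}"
  using pM_least[OF zero_submodule, of n] submodule_zero[OF pM_submodule[of "Suc n"]] by blast

text \<open>For x outside S, the simple submodule Rx annihilates pM, hence equals it, and then p^2M
  = p(Rx) = 0. So S contains every simple submodule of M.\<close>

lemma simple_in_S:
  assumes p1: "pM 1 \<noteq> S" and x: "simple_elem x"
  shows "x \<in> S"
proof (rule ccontr)
  assume xS: "x \<notin> S"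
  let ?X = "cyclic_submodule R M x"
  have xM: "x \<in> carrier M" "x \<noteq> \<zero>\<^bsub>M\<^esub>" using x by (auto simp: simple_elem_def)
  have "?X \<noteq> carrier M"
  proof
    assume "?X = carrier M"
    then have "pM (Suc 0) = {\<zero>\<^bsub>M\<^esub>}"
      using pM_Suc_zero[of 0] simple_elem_killed[OF x] by (simp add: pM_0)
    then show False using nonzero_properD(2)[OF pM1_vertex] by simp
  qed
  then have X: "?X \<in> \<Lambda>"
    using nonzero_properI[OF cyclic_is_submodule cyclic_nonzero] xM by blast
  have XS: "?X \<noteq> S" using cyclic_self[OF xM(1)] xS by blast
  have "?X = pM 1"
    using no_edge[OF X pM1_vertex XS p1 annih_simple[OF x pM_submodule pM1_proper]] .
  then have "pM (Suc 1) = {\<zero>\<^bsub>M\<^esub>}"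
    using pM_Suc_zero[of 1] simple_elem_killed[OF x] by simp
  then show False using pM2_nonzero[OF p1] by (simp add: numeral_2_eq_2)
qed

lemma killed_in_S:
  assumes "pM 1 \<noteq> S" "x \<in> carrier M" "\<And>a. a \<in> p \<Longrightarrow> a \<odot>\<^bsub>M\<^esub> x = \<zero>\<^bsub>M\<^esub>"
  shows "x \<in> S"
proof (cases "x = \<zero>\<^bsub>M\<^esub>")
  case True then show ?thesis using submodule_zero[OF S_submodule] by simp
next
  case False
  then show ?thesis using simple_in_S[OF assms(1) simple_elem_if_killed] assms by blast
qed

lemma S_least:
  assumes p1: "pM 1 \<noteq> S" and N: "submodule N R M" "N \<noteq> {\<zero>\<^bsub>M\<^esub>}"
  shows "S \<subseteq> N"
proof -
  obtain x where x: "x \<in> N" "simple_elem x" using simple_elem_in_submodule[OF N] .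
  then show ?thesis
    using S_minimal[OF N(1) x(1) simple_in_S[OF p1 x(2)]] by (simp add: simple_elem_def)
qed

text \<open>N and K are not adjacent, so NK is nonzero and contains S by \<open>S_least\<close>;
  conversely, NK lies in p^2M = S because both residuals lie in p.\<close>

lemma case_b:
  assumes p1: "pM 1 \<noteq> S" and p2: "pM 2 = S"
  shows "pM 3 = {\<zero>\<^bsub>M\<^esub>}" "{N. minimal_submodule N R M} = {S}"
    and "\<And>N K. \<lbrakk>N \<in> \<Lambda>; K \<in> \<Lambda>; N \<noteq> K; N \<noteq> S; K \<noteq> S\<rbrakk> \<Longrightarrow> submodule_prod R M N K = S"
proof -
  show "pM 3 = {\<zero>\<^bsub>M\<^esub>}" using pM_Suc_zero[of 2] p2 S_killed by simp
  have "minimal_submodule S R M" unfolding S_def by (rule simple_elem_minimal[OF simple])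
  moreover have "N = S" if "minimal_submodule N R M" for N
    using that S_least[OF p1, of N] S_submodule S_nonzero unfolding minimal_submodule_def by blast
  ultimately show "{N. minimal_submodule N R M} = {S}" by blast
  fix N K assume NK: "N \<in> \<Lambda>" "K \<in> \<Lambda>" "N \<noteq> K" "N \<noteq> S" "K \<noteq> S"
  have sN: "submodule N R M" and sK: "submodule K R M"
    using nonzero_properD(1) NK by blast+
  have "\<not> annih N K" using no_edge NK by blast
  then have "submodule_prod R M N K \<noteq> {\<zero>\<^bsub>M\<^esub>}"
    using submodule_prod_zero_iff[OF sN sK] by simp
  then have "S \<subseteq> submodule_prod R M N K"
    by (rule S_least[OF p1 submodule_prod_submodule[OF sN sK]])
  moreover have "submodule_prod R M N K \<subseteq> S"
  proof (rule submodule_prod_least[OF sN sK S_submodule])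
    fix r s x assume rsx: "r \<in> residual R M N" "s \<in> residual R M K" "x \<in> carrier M"
    then have "r \<in> p" "s \<in> p" using residual_p NK by blast+
    then have "r \<odot>\<^bsub>M\<^esub> (s \<odot>\<^bsub>M\<^esub> x) \<in> pM (Suc (Suc 0))"
      using pM_smult rsx(3) pM_0 by simp
    then show "r \<odot>\<^bsub>M\<^esub> (s \<odot>\<^bsub>M\<^esub> x) \<in> S" using p2 by (simp add: numeral_2_eq_2)
  qed
  ultimately show "submodule_prod R M N K = S" by blast
qed

end

section \<open>The case in which S is neither pM nor p^2M\<close>

locale local_star_long = local_star +
  assumes pM1_S: "pM 1 \<noteq> S" and pM2_S: "pM 2 \<noteq> S"
begin

lemma pM3I: "\<lbrakk>a \<in> p; x \<in> pM 2\<rbrakk> \<Longrightarrow> a \<odot>\<^bsub>M\<^esub> x \<in> pM 3"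
  using pM_smult[of a x 2] by simp

lemma pM4I: "\<lbrakk>a \<in> p; x \<in> pM 3\<rbrakk> \<Longrightarrow> a \<odot>\<^bsub>M\<^esub> x \<in> pM 4"
  using pM_smult[of a x 3] by simp

lemma pM2_vertex: "pM 2 \<in> \<Lambda>"
  using nonzero_properI[OF pM_submodule pM2_nonzero[OF pM1_S]] pM_not_carrier[of 1]
  by (simp add: numeral_2_eq_2)

text \<open>Such an N annihilates p^2M, and no edge avoids S.\<close>

lemma annih_pM2:
  assumes "N \<in> \<Lambda>" "\<And>r y. \<lbrakk>r \<in> residual R M N; y \<in> pM 2\<rbrakk> \<Longrightarrow> r \<odot>\<^bsub>M\<^esub> y = \<zero>\<^bsub>M\<^esub>"
  shows "N = S \<or> N = pM 2"
  using no_edge[OF assms(1) pM2_vertex _ pM2_S annihI_right[of N "pM 2"]] assms(2) by blast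

text \<open>If p^3M = 0, then p kills p^2M, which therefore lies in S and equals it.\<close>

lemma pM3_nonzero: "pM 3 \<noteq> {\<zero>\<^bsub>M\<^esub>}"
proof
  assume p3: "pM 3 = {\<zero>\<^bsub>M\<^esub>}"
  have "y \<in> S" if "y \<in> pM 2" for y
    using killed_in_S[OF pM1_S submodule_carrier[OF pM_submodule that]] pM3I[OF _ that] p3 by blast
  then show False
    using pM2_S S_least[OF pM1_S pM_submodule pM2_nonzero[OF pM1_S]] by blast
qed

text \<open>The product of \<open>{x. p\<^sup>2 x = 0}\<close> and \<open>p\<^sup>2 M\<close> is zero, so they coincide.\<close>

lemma pM4_zero: "pM 4 = {\<zero>\<^bsub>M\<^esub>}"
proof -
  define N where "N = {x \<in> carrier M. \<forall>a \<in> p. \<forall>b \<in> p. a \<odot>\<^bsub>M\<^esub> (b \<odot>\<^bsub>M\<^esub> x) = \<zero>\<^bsub>M\<^esub>}"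
  have sN: "submodule N R M"
  proof (rule submoduleI)
    show "r \<odot>\<^bsub>M\<^esub> x \<in> N" if "r \<in> carrier R" "x \<in> N" for r x
    proof -
      have "a \<odot>\<^bsub>M\<^esub> (b \<odot>\<^bsub>M\<^esub> (r \<odot>\<^bsub>M\<^esub> x)) = \<zero>\<^bsub>M\<^esub>" if ab: "a \<in> p" "b \<in> p" for a b
      proof -
        have "a \<odot>\<^bsub>M\<^esub> (b \<odot>\<^bsub>M\<^esub> (r \<odot>\<^bsub>M\<^esub> x)) = r \<odot>\<^bsub>M\<^esub> (a \<odot>\<^bsub>M\<^esub> (b \<odot>\<^bsub>M\<^esub> x))"
          using smult_rotate[OF p_carrier[OF ab(1)] p_carrier[OF ab(2)] \<open>r \<in> carrier R\<close>]
            \<open>x \<in> N\<close> unfolding N_def by blast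
        then show ?thesis using ab \<open>x \<in> N\<close> \<open>r \<in> carrier R\<close> unfolding N_def by simp
      qed
      then show ?thesis using that unfolding N_def by simp
    qed
    show "\<ominus>\<^bsub>M\<^esub> x \<in> N" if "x \<in> N" for x
      using that p_carrier unfolding N_def by (simp add: smult_r_minus)
    show "x \<oplus>\<^bsub>M\<^esub> y \<in> N" if "x \<in> N" "y \<in> N" for x y
      using that p_carrier unfolding N_def by (simp add: smult_r_distr)
  qed (use p_carrier in \<open>auto simp: N_def\<close>)
  have "S \<subseteq> N"
    unfolding N_def using S_killed submodule_carrier[OF S_submodule] p_carrier by auto
  moreover have "N \<noteq> carrier M"
  proof
    assume "N = carrier M"
    then have "pM 2 \<subseteq> {\<zero>\<^bsub>M\<^esub>}" using pM2_least[OF zero_submodule] unfolding N_def by blast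
    then show False
      using pM2_nonzero[OF pM1_S] submodule_zero[OF pM_submodule[of 2]] by blast
  qed
  ultimately have N: "N \<in> \<Lambda>" using nonzero_properI[OF sN nonzero_if_S_subset] by blast
  have "N = S \<or> N = pM 2"
  proof (rule annih_pM2[OF N])
    fix r y assume r: "r \<in> residual R M N" and y: "y \<in> pM 2"
    have rR: "r \<in> carrier R" using residual_carrier[OF r] .
    \<comment> \<open>Scalars commute, so r(abx) = ab(rx), and rx lies in N.\<close>
    have "pM 2 \<subseteq> {y \<in> carrier M. r \<odot>\<^bsub>M\<^esub> y = \<zero>\<^bsub>M\<^esub>}"
    proof (rule pM2_least[OF kernel_submodule[OF rR]])
      fix a b x assume abx: "a \<in> p" "b \<in> p" "x \<in> carrier M"
      have "r \<odot>\<^bsub>M\<^esub> (a \<odot>\<^bsub>M\<^esub> (b \<odot>\<^bsub>M\<^esub> x)) = a \<odot>\<^bsub>M\<^esub> (b \<odot>\<^bsub>M\<^esub> (r \<odot>\<^bsub>M\<^esub> x))"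
        using smult_rotate[OF p_carrier[OF abx(1)] p_carrier[OF abx(2)] rR abx(3)] by simp
      then show "a \<odot>\<^bsub>M\<^esub> (b \<odot>\<^bsub>M\<^esub> x) \<in> {y \<in> carrier M. r \<odot>\<^bsub>M\<^esub> y = \<zero>\<^bsub>M\<^esub>}"
        using residual_smult[OF r abx(3)] abx p_carrier unfolding N_def by simp
    qed
    then show "r \<odot>\<^bsub>M\<^esub> y = \<zero>\<^bsub>M\<^esub>" using y by blast
  qed
  \<comment> \<open>An element y outside S with py inside S is killed by p^2, so N is larger than
    S.\<close>
  moreover have "N \<noteq> S"
  proof
    assume NS: "N = S"
    obtain v where "v \<in> carrier M" "v \<notin> S"
      using nonzero_properD(3)[OF S_vertex] submoduleE(1)[OF S_submodule] by blast
    then obtain y where y: "y \<in> carrier M" "y \<notin> S" "\<And>a. a \<in> p \<Longrightarrow> a \<odot>\<^bsub>M\<^esub> y \<in> S"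
      using nakayama_minimal[of v S] submodule_zero[OF S_submodule] by metis
    then have "y \<in> N" unfolding N_def using S_killed by simp
    then show False using NS y(2) by blast
  qed
  ultimately have N2: "N = pM 2" by blast
  have "pM (Suc 3) = {\<zero>\<^bsub>M\<^esub>}"
  proof (rule pM_Suc_zero)
    fix a x assume a: "a \<in> p" and x: "x \<in> pM 3"
    have "pM (Suc 2) \<subseteq> {y \<in> carrier M. a \<odot>\<^bsub>M\<^esub> y = \<zero>\<^bsub>M\<^esub>}"
    proof (rule pM_least[OF kernel_submodule[OF p_carrier[OF a]]])
      fix b y assume "b \<in> p" "y \<in> pM 2"
      then show "b \<odot>\<^bsub>M\<^esub> y \<in> {y \<in> carrier M. a \<odot>\<^bsub>M\<^esub> y = \<zero>\<^bsub>M\<^esub>}"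
        using N2 a p_carrier unfolding N_def by auto
    qed
    then show "a \<odot>\<^bsub>M\<^esub> x = \<zero>\<^bsub>M\<^esub>" using x by auto
  qed
  then show ?thesis by simp
qed

lemma pM3_S: "pM 3 = S"
proof
  show "S \<subseteq> pM 3" using S_least[OF pM1_S pM_submodule pM3_nonzero] .
  show "pM 3 \<subseteq> S"
    using killed_in_S[OF pM1_S] submodule_carrier[OF pM_submodule] pM4I pM4_zero by blast
qed

text \<open>cM annihilates p^2M because c kills it, and cM is not S because p does not kill cM. As
  no edge avoids S, only cM = p^2M remains.\<close>

lemma image_killing_pM2:
  assumes c: "c \<in> carrier R" and kill: "\<And>y. y \<in> pM 2 \<Longrightarrow> c \<odot>\<^bsub>M\<^esub> y = \<zero>\<^bsub>M\<^esub>"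
    and b: "b \<in> p" and v: "v \<in> carrier M" "b \<odot>\<^bsub>M\<^esub> (c \<odot>\<^bsub>M\<^esub> v) \<noteq> \<zero>\<^bsub>M\<^esub>"
  shows "(\<lambda>x. c \<odot>\<^bsub>M\<^esub> x) ` carrier M = pM 2"
proof -
  let ?C = "(\<lambda>x. c \<odot>\<^bsub>M\<^esub> x) ` carrier M"
  have sC: "submodule ?C R M" using image_submodule[OF c carrier_is_submodule] .
  have "c \<odot>\<^bsub>M\<^esub> v \<in> ?C" using v(1) by blast
  moreover have "c \<odot>\<^bsub>M\<^esub> v \<noteq> \<zero>\<^bsub>M\<^esub>" using v(2) smult_r_null[OF p_carrier[OF b]] by auto
  ultimately have "?C \<noteq> {\<zero>\<^bsub>M\<^esub>}" by blast
  moreover have "?C \<noteq> carrier M"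
  proof
    \<comment> \<open>cM = M would give p^2M = p^2(cM) = c(p^2M) = 0.\<close>
    assume full: "?C = carrier M"
    have "pM 2 \<subseteq> {\<zero>\<^bsub>M\<^esub>}"
    proof (rule pM2_least[OF zero_submodule])
      fix a d x assume ad: "a \<in> p" "d \<in> p" and "x \<in> carrier M"
      then have "x \<in> ?C" unfolding full by simp
      then obtain z where z: "z \<in> carrier M" "x = c \<odot>\<^bsub>M\<^esub> z" by blast
      have "a \<odot>\<^bsub>M\<^esub> (d \<odot>\<^bsub>M\<^esub> x) = c \<odot>\<^bsub>M\<^esub> (a \<odot>\<^bsub>M\<^esub> (d \<odot>\<^bsub>M\<^esub> z))"
        unfolding z(2) by (rule smult_rotate[OF p_carrier[OF ad(1)] p_carrier[OF ad(2)] c z(1)])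
      then show "a \<odot>\<^bsub>M\<^esub> (d \<odot>\<^bsub>M\<^esub> x) \<in> {\<zero>\<^bsub>M\<^esub>}" using kill[OF pM2I[OF ad z(1)]] by simp
    qed
    then show False
      using pM2_nonzero[OF pM1_S] submodule_zero[OF pM_submodule[of 2]] by blast
  qed
  ultimately have C: "?C \<in> \<Lambda>" using nonzero_properI[OF sC] by blast
  moreover have "?C \<noteq> S" using S_killed[OF b] v by blast
  ultimately show ?thesis
    using no_edge[OF C pM2_vertex _ pM2_S annih_imageI[OF c kill]] by blast
qed

text \<open>An element of \<open>p\<close> not killing \<open>p\<^sup>2 M\<close> does not square to zero on \<open>M\<close>: if \<open>xyz\<close> is
  nonzero on \<open>M\<close>, then \<open>xyM = p\<^sup>2 M\<close>, so \<open>x\<^sup>2 y\<close> is nonzero on \<open>M\<close>, so \<open>x\<^sup>2 M = p\<^sup>2 M\<close>.\<close>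

lemma square_image:
  assumes x: "x \<in> p" and w: "w \<in> pM 2" "x \<odot>\<^bsub>M\<^esub> w \<noteq> \<zero>\<^bsub>M\<^esub>"
  shows "(\<lambda>v. (x \<otimes> x) \<odot>\<^bsub>M\<^esub> v) ` carrier M = pM 2"
proof -
  have xR: "x \<in> carrier R" using p_carrier[OF x] .
  \<comment> \<open>Because p^4M = 0, products of two elements of p kill p^2M, as
    \<open>image_killing_pM2\<close> requires of its scalar.\<close>
  have kill: "(x \<otimes> b) \<odot>\<^bsub>M\<^esub> y = \<zero>\<^bsub>M\<^esub>" if "b \<in> p" "y \<in> pM 2" for b y
  proof -
    have "(x \<otimes> b) \<odot>\<^bsub>M\<^esub> y = x \<odot>\<^bsub>M\<^esub> (b \<odot>\<^bsub>M\<^esub> y)"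
      using xR p_carrier[OF that(1)] submodule_carrier[OF pM_submodule that(2)]
      by (simp add: smult_assoc1)
    then show ?thesis using pM4I[OF x pM3I[OF that]] pM4_zero by simp
  qed
  have "\<exists>y \<in> p. \<exists>z \<in> p. \<exists>v \<in> carrier M. x \<odot>\<^bsub>M\<^esub> (y \<odot>\<^bsub>M\<^esub> (z \<odot>\<^bsub>M\<^esub> v)) \<noteq> \<zero>\<^bsub>M\<^esub>"
  proof (rule ccontr)
    assume "\<not> ?thesis"
    then have "pM 2 \<subseteq> {y \<in> carrier M. x \<odot>\<^bsub>M\<^esub> y = \<zero>\<^bsub>M\<^esub>}"
      using p_carrier by (intro pM2_least[OF kernel_submodule[OF xR]]) auto
    then show False using w by blast
  qed
  then obtain y z v where yzv: "y \<in> p" "z \<in> p" "v \<in> carrier M"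
    "x \<odot>\<^bsub>M\<^esub> (y \<odot>\<^bsub>M\<^esub> (z \<odot>\<^bsub>M\<^esub> v)) \<noteq> \<zero>\<^bsub>M\<^esub>" by blast
  have yR: "y \<in> carrier R" and zR: "z \<in> carrier R" using yzv p_carrier by auto
  have "z \<odot>\<^bsub>M\<^esub> ((x \<otimes> y) \<odot>\<^bsub>M\<^esub> v) = x \<odot>\<^bsub>M\<^esub> (y \<odot>\<^bsub>M\<^esub> (z \<odot>\<^bsub>M\<^esub> v))"
    using smult_rotate[OF xR yR zR yzv(3)] xR yR yzv(3) by (simp add: smult_assoc1)
  then have "(\<lambda>v. (x \<otimes> y) \<odot>\<^bsub>M\<^esub> v) ` carrier M = pM 2"
    using image_killing_pM2[of "x \<otimes> y" z v] kill[OF yzv(1)] xR yR yzv by auto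
  then obtain v' where v': "v' \<in> carrier M" "w = (x \<otimes> y) \<odot>\<^bsub>M\<^esub> v'" using w(1) by blast
  \<comment> \<open>Here w = xyv', so xw is also y applied to xxv'. It is nonzero, which is the
    remaining hypothesis of \<open>image_killing_pM2\<close> for the scalar xx.\<close>
  have "y \<odot>\<^bsub>M\<^esub> ((x \<otimes> x) \<odot>\<^bsub>M\<^esub> v') = x \<odot>\<^bsub>M\<^esub> w"
    using smult_rotate[OF xR xR yR v'(1)] xR yR v' by (simp add: smult_assoc1)
  then show ?thesis
    using image_killing_pM2[of "x \<otimes> x" y v'] kill[OF x] xR yzv(1) v'(1) w(2) by auto
qed

text \<open>The kernel N of a is nonzero and proper. Once (N : M) is shown to kill p^2M, N is S or
  p^2M, and a does not kill p^2M.\<close>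

lemma kernel_eq_S:
  assumes a: "a \<in> p" and w: "w \<in> pM 2" "a \<odot>\<^bsub>M\<^esub> w \<noteq> \<zero>\<^bsub>M\<^esub>"
  shows "{v \<in> carrier M. a \<odot>\<^bsub>M\<^esub> v = \<zero>\<^bsub>M\<^esub>} = S"
proof -
  let ?N = "{v \<in> carrier M. a \<odot>\<^bsub>M\<^esub> v = \<zero>\<^bsub>M\<^esub>}"
  have aR: "a \<in> carrier R" using p_carrier[OF a] .
  have wM: "w \<in> carrier M" using submodule_carrier[OF pM_submodule w(1)] .
  have sN: "submodule ?N R M" using kernel_submodule[OF aR] .
  have "S \<subseteq> ?N" using S_killed[OF a] submodule_carrier[OF S_submodule] by blast
  moreover have "?N \<noteq> carrier M" using w wM by blast
  ultimately have N: "?N \<in> \<Lambda>" using nonzero_properI[OF sN nonzero_if_S_subset] by blast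
  have img: "(\<lambda>v. b \<odot>\<^bsub>M\<^esub> v) ` carrier M \<in> \<Lambda> - {S}"
    if b: "b \<in> p" and u: "u \<in> pM 2" "b \<odot>\<^bsub>M\<^esub> u \<noteq> \<zero>\<^bsub>M\<^esub>" for b u
  proof -
    let ?B = "(\<lambda>v. b \<odot>\<^bsub>M\<^esub> v) ` carrier M"
    have bR: "b \<in> carrier R" using p_carrier[OF b] .
    have sB: "submodule ?B R M" using image_submodule[OF bR carrier_is_submodule] .
    have "?B \<noteq> {\<zero>\<^bsub>M\<^esub>}" using u submodule_carrier[OF pM_submodule u(1)] by blast
    moreover have "?B \<subseteq> pM 1" using pM_smult[OF b, of _ 0] by (auto simp: pM_0)
    ultimately have "?B \<in> \<Lambda>" using vertex_if_subset[OF pM1_vertex _ sB] by blast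
    moreover have "?B \<noteq> S"
    proof
      assume BS: "?B = S"
      \<comment> \<open>If bM = S, then b(cdx) = c(bdx) with bdx in S, so b would kill p^2M.\<close>
      have "pM 2 \<subseteq> {y \<in> carrier M. b \<odot>\<^bsub>M\<^esub> y = \<zero>\<^bsub>M\<^esub>}"
      proof (rule pM2_least[OF kernel_submodule[OF bR]])
        fix c d x assume cd: "c \<in> p" "d \<in> p" and x: "x \<in> carrier M"
        have cdR: "c \<in> carrier R" "d \<in> carrier R" using cd p_carrier by auto
        have "b \<odot>\<^bsub>M\<^esub> (c \<odot>\<^bsub>M\<^esub> (d \<odot>\<^bsub>M\<^esub> x)) = c \<odot>\<^bsub>M\<^esub> (b \<odot>\<^bsub>M\<^esub> (d \<odot>\<^bsub>M\<^esub> x))"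
          using smult_lcomm[of b c "d \<odot>\<^bsub>M\<^esub> x"] bR cdR x by simp
        also have "\<dots> = \<zero>\<^bsub>M\<^esub>" using S_killed[OF cd(1)] BS cdR x by blast
        finally show "c \<odot>\<^bsub>M\<^esub> (d \<odot>\<^bsub>M\<^esub> x) \<in> {y \<in> carrier M. b \<odot>\<^bsub>M\<^esub> y = \<zero>\<^bsub>M\<^esub>}" using cdR x by simp
      qed
      then show False using u by blast
    qed
    ultimately show ?thesis by blast
  qed
  have "?N = S \<or> ?N = pM 2"
  proof (rule annih_pM2[OF N])
    fix y u assume y: "y \<in> residual R M ?N" and u: "u \<in> pM 2"
    show "y \<odot>\<^bsub>M\<^esub> u = \<zero>\<^bsub>M\<^esub>"
    proof (rule ccontr)
      assume yu: "y \<odot>\<^bsub>M\<^esub> u \<noteq> \<zero>\<^bsub>M\<^esub>"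
      let ?Y = "(\<lambda>v. y \<odot>\<^bsub>M\<^esub> v) ` carrier M" and ?A = "(\<lambda>v. a \<odot>\<^bsub>M\<^esub> v) ` carrier M"
      have yp: "y \<in> p" using y residual_p[OF N] by blast
      have yR: "y \<in> carrier R" using p_carrier[OF yp] .
      have ay: "a \<odot>\<^bsub>M\<^esub> (y \<odot>\<^bsub>M\<^esub> v) = \<zero>\<^bsub>M\<^esub>" if "v \<in> carrier M" for v
        using residual_smult[OF y that] by blast
      \<comment> \<open>As a kills yM, the submodules aM and yM annihilate each other. Both are
        vertices other than S, so they coincide, and then a kills aM; but a^2M = p^2M is
        nonzero.\<close>
      have "annih ?A ?Y" by (rule annih_imageI[OF aR]) (use ay in blast)
      then have eq: "?A = ?Y"
        using no_edge[of ?A ?Y] img[OF a w] img[OF yp u yu] by blast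
      have "(a \<otimes> a) \<odot>\<^bsub>M\<^esub> v = \<zero>\<^bsub>M\<^esub>" if v: "v \<in> carrier M" for v
      proof -
        have "a \<odot>\<^bsub>M\<^esub> v \<in> ?Y" unfolding eq[symmetric] using v by blast
        then show ?thesis using ay v aR by (auto simp: smult_assoc1)
      qed
      then have "pM 2 \<subseteq> {\<zero>\<^bsub>M\<^esub>}" unfolding square_image[OF a w, symmetric] by blast
      then show False
        using pM2_nonzero[OF pM1_S] submodule_zero[OF pM_submodule[of 2]] by blast
    qed
  qed
  moreover have "?N \<noteq> pM 2" using w by blast
  ultimately show ?thesis by blast
qed

text \<open>Some a in (N : M) does not kill p^2M. For b in p, abx lies in p^2M = a^2M, say abx =
  aav. Then bx - av is in the kernel S of a, which N contains, and av is in N.\<close>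

lemma pM1_subset:
  assumes N: "N \<in> \<Lambda>" "N \<noteq> S" "N \<noteq> pM 2"
  shows "pM 1 \<subseteq> N"
proof -
  obtain a w where a: "a \<in> residual R M N" and w: "w \<in> pM 2" "a \<odot>\<^bsub>M\<^esub> w \<noteq> \<zero>\<^bsub>M\<^esub>"
    using annih_pM2[OF N(1)] N(2,3) by blast
  have sN: "submodule N R M" using nonzero_properD(1)[OF N(1)] .
  have ap: "a \<in> p" using a residual_p[OF N(1)] by blast
  have aR: "a \<in> carrier R" using p_carrier[OF ap] .
  have "pM (Suc 0) \<subseteq> N"
  proof (rule pM_least[OF sN])
    fix b x assume b: "b \<in> p" and "x \<in> pM 0"
    then have x: "x \<in> carrier M" by (simp add: pM_0)
    have bx: "b \<odot>\<^bsub>M\<^esub> x \<in> carrier M" using p_carrier[OF b] x by simp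
    have "a \<odot>\<^bsub>M\<^esub> (b \<odot>\<^bsub>M\<^esub> x) \<in> (\<lambda>v. (a \<otimes> a) \<odot>\<^bsub>M\<^esub> v) ` carrier M"
      unfolding square_image[OF ap w] using pM2I[OF ap b x] .
    then obtain v where v: "v \<in> carrier M" "a \<odot>\<^bsub>M\<^esub> (b \<odot>\<^bsub>M\<^esub> x) = a \<odot>\<^bsub>M\<^esub> (a \<odot>\<^bsub>M\<^esub> v)"
      using aR by (auto simp: smult_assoc1)
    then have "a \<odot>\<^bsub>M\<^esub> (b \<odot>\<^bsub>M\<^esub> x \<ominus>\<^bsub>M\<^esub> a \<odot>\<^bsub>M\<^esub> v) = \<zero>\<^bsub>M\<^esub>"
      using smult_diff[OF aR bx smult_closed[OF aR v(1)]] aR v(1) by (simp add: M.minus_eq M.r_neg)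
    then have "b \<odot>\<^bsub>M\<^esub> x \<ominus>\<^bsub>M\<^esub> a \<odot>\<^bsub>M\<^esub> v \<in> S"
      unfolding kernel_eq_S[OF ap w, symmetric] using aR bx v(1) by simp
    then have "b \<odot>\<^bsub>M\<^esub> x \<ominus>\<^bsub>M\<^esub> a \<odot>\<^bsub>M\<^esub> v \<in> N"
      using S_least[OF pM1_S sN nonzero_properD(2)[OF N(1)]] by blast
    then show "b \<odot>\<^bsub>M\<^esub> x \<in> N"
      using submodule_diff_cancel[OF sN bx residual_smult[OF a v(1)]] by blast
  qed
  then show ?thesis by simp
qed

text \<open>The proper N with (N : M) = p are those containing pM, and pM is one of them. By
  \<open>pM1_subset\<close>, every vertex other than S = p^3M and p^2M is of this kind.\<close>

lemma case_c:
  "\<Lambda> = {N. proper_submodule N R M \<and> residual R M N = residual R M (pM 1)} \<union> {pM 2, pM 3}"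
proof -
  have res1: "residual R M (pM 1) = p"
    using residual_eq_p[OF pM_submodule pM1_proper] by blast
  have "N \<in> \<Lambda>" if "proper_submodule N R M" "residual R M N = p" for N
  proof -
    have sN: "submodule N R M" using that unfolding proper_submodule_def by blast
    have "pM (Suc 0) \<subseteq> N"
      by (rule pM_least[OF sN]) (use that residual_smult[of _ N] pM_0 in auto)
    then have "N \<noteq> {\<zero>\<^bsub>M\<^esub>}" using nonzero_if_S_subset S_subset_pM1 by auto
    then show ?thesis using that unfolding nonzero_proper_submodules_def by blast
  qed
  moreover have "proper_submodule N R M \<and> residual R M N = p" if "N \<in> \<Lambda>" "N \<noteq> S" "N \<noteq> pM 2" for N
    using residual_eq_p[OF _ _ pM1_subset[OF that]] nonzero_properD[OF that(1)]
    unfolding proper_submodule_def by blast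
  ultimately show ?thesis using S_vertex pM2_vertex unfolding res1 pM3_S by blast
qed

end

section \<open>The equivalence over a local ring\<close>

context local_artinian_module
begin

lemma elem_annihilator_simple:
  assumes "m \<in> carrier M" "m \<noteq> \<zero>\<^bsub>M\<^esub>" "p = elem_annihilator R M m"
  shows "simple_elem m"
  using simple_elem_if_killed[OF assms(1,2)] assms(3) unfolding elem_annihilator_def by blast

text \<open>If p^(n+1)M = M, then already pM = M, and all further powers give M as well.\<close>

lemma pM_proper:
  assumes "pM (n + k) \<noteq> carrier M"
  shows "pM (Suc n) \<noteq> carrier M"
proof
  assume full: "pM (Suc n) = carrier M"
  have "pM (Suc n) \<subseteq> pM 1"
    by (induction n) (use pM_decreasing in auto)
  then have "pM (Suc 0) = pM 0"
    using full submoduleE(1)[OF pM_submodule[of 1]] by (auto simp: pM_0)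
  then show False using pM_fixed[of 0 "n + k"] assms pM_0 by simp
qed

lemma cyclic_annih:
  assumes m: "simple_elem m" and N: "N \<in> \<Lambda>"
  shows "annih (cyclic_submodule R M m) N"
  using annih_simple[OF m] nonzero_properD[OF N] by blast

lemma cyclic_vertex:
  assumes m: "simple_elem m" and ne: "cyclic_submodule R M m \<noteq> carrier M"
  shows "cyclic_submodule R M m \<in> \<Lambda>"
  using nonzero_properI[OF cyclic_is_submodule cyclic_nonzero ne] m by (simp add: simple_elem_def)

text \<open>Rm serves as the centre: it annihilates every nonzero proper submodule, itself
  included.\<close>

lemma star_if_no_edge:
  assumes m: "simple_elem m" and ne: "cyclic_submodule R M m \<noteq> carrier M"
    and no: "\<And>N K. \<lbrakk>N \<in> \<Lambda>; K \<in> \<Lambda>; N \<noteq> K; N \<noteq> cyclic_submodule R M m; K \<noteq> cyclic_submodule R M m\<rbrakk>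
      \<Longrightarrow> \<not> annih N K"
  shows "star_graph (AG R M)"
proof -
  note V = cyclic_vertex[OF m ne]
  show ?thesis
    by (rule star_graphI[OF V V cyclic_annih[OF m V] cyclic_annih[OF m]]) (use no in blast)+
qed

text \<open>With (N : M) = p and p^2 inside (K : M), the relation NK = 0 says that the product of
  any three elements of p kills M.\<close>

lemma pM3_zero_if_annih:
  assumes N: "residual R M N = p" and K: "\<And>b c. \<lbrakk>b \<in> p; c \<in> p\<rbrakk> \<Longrightarrow> b \<otimes> c \<in> residual R M K"
    and ann: "annih N K"
  shows "pM 3 = {\<zero>\<^bsub>M\<^esub>}"
proof -
  have "pM (Suc 2) \<subseteq> {\<zero>\<^bsub>M\<^esub>}"
  proof (rule pM_least[OF zero_submodule])
    fix a y assume a: "a \<in> p" and y: "y \<in> pM 2"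
    have "pM 2 \<subseteq> {y \<in> carrier M. a \<odot>\<^bsub>M\<^esub> y = \<zero>\<^bsub>M\<^esub>}"
    proof (rule pM2_least[OF kernel_submodule[OF p_carrier[OF a]]])
      fix b c x assume bc: "b \<in> p" "c \<in> p" and x: "x \<in> carrier M"
      have "a \<odot>\<^bsub>M\<^esub> ((b \<otimes> c) \<odot>\<^bsub>M\<^esub> x) = \<zero>\<^bsub>M\<^esub>"
        using ann a K[OF bc] x unfolding annih_def N by blast
      then show "b \<odot>\<^bsub>M\<^esub> (c \<odot>\<^bsub>M\<^esub> x) \<in> {y \<in> carrier M. a \<odot>\<^bsub>M\<^esub> y = \<zero>\<^bsub>M\<^esub>}"
        using bc x p_carrier by (simp add: smult_assoc1)
    qed
    then show "a \<odot>\<^bsub>M\<^esub> y \<in> {\<zero>\<^bsub>M\<^esub>}" using y by blast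
  qed
  then show ?thesis using submodule_zero[OF pM_submodule[of 3]] by auto
qed

lemma star_local_iff:
  "star_graph (AG R M) \<longleftrightarrow> (\<exists>m. m \<in> carrier M \<and> m \<noteq> \<zero>\<^bsub>M\<^esub> \<and>
     p = elem_annihilator R M m \<and> p \<in> associated_primes R M \<and>
     ((pM 2 = {\<zero>\<^bsub>M\<^esub>} \<and> pM 1 = cyclic_submodule R M m \<and> \<Lambda> = {cyclic_submodule R M m}) \<or>
      (pM 3 = {\<zero>\<^bsub>M\<^esub>} \<and> pM 2 = cyclic_submodule R M m \<and>
        {N. minimal_submodule N R M} = {cyclic_submodule R M m} \<and>
        (\<forall>N1 \<in> \<Lambda>. \<forall>N2 \<in> \<Lambda>. N1 \<noteq> N2 \<and> N1 \<noteq> cyclic_submodule R M m \<and>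
           N2 \<noteq> cyclic_submodule R M m \<longrightarrow> submodule_prod R M N1 N2 = cyclic_submodule R M m)) \<or>
      (pM 4 = {\<zero>\<^bsub>M\<^esub>} \<and> pM 3 \<noteq> {\<zero>\<^bsub>M\<^esub>} \<and> pM 3 = cyclic_submodule R M m \<and>
        \<Lambda> = {N. proper_submodule N R M \<and> residual R M N = residual R M (pM 1)} \<union> {pM 2, pM 3})))"
    (is "_ \<longleftrightarrow> (\<exists>m. _ \<and> _ \<and> _ \<and> _ \<and> (?A m \<or> ?B m \<or> ?C m))")
proof
  assume star: "star_graph (AG R M)"
  obtain N where N: "N \<in> \<Lambda>" using star_center[OF star] by metis
  have sN: "submodule N R M" using nonzero_properD(1)[OF N] .
  \<comment> \<open>Any simple element inside a vertex will do; lying in a proper submodule keeps Rm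
    proper.\<close>
  obtain m where m: "m \<in> N" "simple_elem m"
    using simple_elem_in_submodule[OF nonzero_properD(1,2)[OF N]] .
  have "cyclic_submodule R M m \<subseteq> N" using cyclic_subset[OF sN m(1)] .
  then have "cyclic_submodule R M m \<noteq> carrier M"
    using nonzero_properD(3)[OF N] submoduleE(1)[OF sN] by blast
  then interpret local_star R M p m
    by (intro local_star.intro local_star_axioms.intro local_artinian_module_axioms star m(2))
  have "?A m \<or> ?B m \<or> ?C m"
  proof (cases "pM 1 = S")
    case True
    then show ?thesis using case_a[OF True] unfolding S_def by blast
  next
    case p1: False
    show ?thesis
    proof (cases "pM 2 = S")
      case True
      then show ?thesis using case_b[OF p1 True] unfolding S_def by simp
    next
      case False
      interpret local_star_long R M p m by unfold_locales (fact p1 False)+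
      show ?thesis using pM4_zero pM3_nonzero pM3_S case_c unfolding S_def by blast
    qed
  qed
  moreover have pm: "p = elem_annihilator R M m" using simple_elem_annihilator[OF m(2)] by simp
  moreover have "p \<in> associated_primes R M"
    unfolding associated_primes_def
    using R.maximalideal_prime[OF p_maximal] pm m_carrier m_nonzero by blast
  ultimately show "\<exists>m. m \<in> carrier M \<and> m \<noteq> \<zero>\<^bsub>M\<^esub> \<and> p = elem_annihilator R M m \<and>
      p \<in> associated_primes R M \<and> (?A m \<or> ?B m \<or> ?C m)"
    using m_carrier m_nonzero by (intro exI[of _ m] conjI)
next
  assume "\<exists>m. m \<in> carrier M \<and> m \<noteq> \<zero>\<^bsub>M\<^esub> \<and> p = elem_annihilator R M m \<and>
      p \<in> associated_primes R M \<and> (?A m \<or> ?B m \<or> ?C m)"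
  then obtain m where m: "m \<in> carrier M" "m \<noteq> \<zero>\<^bsub>M\<^esub>" "p = elem_annihilator R M m"
    and abc: "?A m \<or> ?B m \<or> ?C m" by (elim exE conjE)
  let ?S = "cyclic_submodule R M m"
  have simple: "simple_elem m" using elem_annihilator_simple[OF m] .
  have S0: "?S \<noteq> {\<zero>\<^bsub>M\<^esub>}" using cyclic_nonzero[OF m(1,2)] .
  have M0: "carrier M \<noteq> {\<zero>\<^bsub>M\<^esub>}" using m by blast
  from abc show "star_graph (AG R M)"
  proof (elim disjE)
    assume A: "?A m"
    then have "?S \<in> \<Lambda>" by simp
    then show ?thesis
      by (intro star_if_no_edge[OF simple nonzero_properD(3)]) (use A in auto)
  next
    assume B: "?B m"
    then have "?S \<noteq> carrier M" using pM_proper[of 1 2] M0 by (simp add: numeral_2_eq_2 numeral_3_eq_3)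
    then show ?thesis
    proof (rule star_if_no_edge[OF simple])
      fix N K assume NK: "N \<in> \<Lambda>" "K \<in> \<Lambda>" "N \<noteq> K" "N \<noteq> ?S" "K \<noteq> ?S"
      then have "submodule_prod R M N K = ?S" using B by simp
      then show "\<not> annih N K"
        using S0 submodule_prod_zero_iff[OF nonzero_properD(1)[OF NK(1)] nonzero_properD(1)[OF NK(2)]]
        by simp
    qed
  next
    assume C: "?C m"
    have p4: "pM (n + (4 - n)) \<noteq> carrier M" if "n \<le> 4" for n :: nat
      using C M0 that by simp
    have ne: "?S \<noteq> carrier M" using C pM_proper[OF p4[of 2]] by (simp add: numeral_3_eq_3 numeral_2_eq_2)
    have "pM 1 \<noteq> carrier M" using pM_proper[OF p4[of 0]] by simp
    then have res1: "residual R M (pM 1) = p" using residual_eq_p[OF pM_submodule] by blast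
    \<comment> \<open>Since p^3M = mR in case (c), p^2M is the only vertex besides mR that is not
      forced to have residual p.\<close>
    have dich: "residual R M N = p \<or> N = pM 2" if "N \<in> \<Lambda>" "N \<noteq> ?S" for N
      using that C res1 by blast
    have prod: "b \<otimes> c \<in> residual R M N" if "N \<in> \<Lambda>" "N \<noteq> ?S" "b \<in> p" "c \<in> p" for N b c
      using dich[OF that(1,2)]
    proof
      assume "residual R M N = p"
      then show ?thesis using ideal.I_l_closed[OF p_ideal that(4) p_carrier[OF that(3)]] by simp
    next
      assume "N = pM 2"
      then show ?thesis using pM2I[OF that(3,4)] p_carrier that(3,4)
        by (simp add: residual_def smult_assoc1)
    qed
    show ?thesis
    proof (rule star_if_no_edge[OF simple ne], rule notI)
      fix N K assume NK: "N \<in> \<Lambda>" "K \<in> \<Lambda>" "N \<noteq> K" "N \<noteq> ?S" "K \<noteq> ?S" and ann: "annih N K"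
      \<comment> \<open>N and K are distinct, so at most one of them is p^2M; the other has residual
        p, and p^2 lies in both residuals.\<close>
      have "residual R M N = p \<or> residual R M K = p" using dich NK by blast
      then have "pM 3 = {\<zero>\<^bsub>M\<^esub>}"
      proof
        assume "residual R M N = p"
        then show ?thesis by (rule pM3_zero_if_annih[OF _ prod[OF NK(2,5)] ann])
      next
        assume "residual R M K = p"
        then show ?thesis
          by (rule pM3_zero_if_annih[OF _ prod[OF NK(1,4)] ann[unfolded annih_commute[of N K]]])
      qed
      then show False using C by blast
    qed
  qed
qed

end

theorem theorem2p14:
  fixes R :: "('a, 'c) ring_scheme" and M :: "('a, 'b, 'd) module_scheme"
  assumes "module R M" and "\<one>\<^bsub>R\<^esub> \<noteq> \<zero>\<^bsub>R\<^esub>"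
    and "artinian_ring R"
    and "carrier M \<notin> pverts (AG R M)"
    and "nil_ideal (annihilator R M) R"
  shows "star_graph (AG R M) \<longleftrightarrow>
    (\<exists>M1 M2. direct_sum R M M1 M2 \<and>
       simple_module R (M\<lparr>carrier := M1\<rparr>) \<and> simple_module R (M\<lparr>carrier := M2\<rparr>)) \<or>
    (\<exists>p m. local_ring_with R p \<and> m \<in> carrier M \<and> m \<noteq> \<zero>\<^bsub>M\<^esub> \<and>
       p = elem_annihilator R M m \<and> p \<in> associated_primes R M \<and>
       (let pM = (\<lambda>n :: nat. ideal_smult R M (ideal_power R p n) (carrier M));
            mR = cyclic_submodule R M m
        in
         (pM 2 = {\<zero>\<^bsub>M\<^esub>} \<and> pM 1 = mR \<and> nonzero_proper_submodules R M = {mR}) \<or>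
         (pM 3 = {\<zero>\<^bsub>M\<^esub>} \<and> pM 2 = mR \<and> {N. minimal_submodule N R M} = {mR} \<and>
           (\<forall>N1 \<in> nonzero_proper_submodules R M. \<forall>N2 \<in> nonzero_proper_submodules R M.
              N1 \<noteq> N2 \<and> N1 \<noteq> mR \<and> N2 \<noteq> mR \<longrightarrow> submodule_prod R M N1 N2 = mR)) \<or>
         (pM 4 = {\<zero>\<^bsub>M\<^esub>} \<and> pM 3 \<noteq> {\<zero>\<^bsub>M\<^esub>} \<and> pM 3 = mR \<and>
           nonzero_proper_submodules R M =
             {N. proper_submodule N R M \<and> residual R M N = residual R M (pM 1)}
               \<union> {pM 2, pM 3})))"
    (is "?star \<longleftrightarrow> ?sum \<or> (\<exists>p m. local_ring_with R p \<and> ?loc p m)")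
proof -
  interpret nonvertex_artinian_module R M
    by (intro nonvertex_artinian_module.intro artinian_module.intro
        nonvertex_artinian_module_axioms.intro assms)
  \<comment> \<open>For a local ring, being a star is equivalent to the second alternative with this
    p; when there is no such p, a star leads to the direct sum.\<close>
  have local_iff: "?star \<longleftrightarrow> (\<exists>m. ?loc p m)" if "local_ring_with R p" for p
  proof -
    interpret local_artinian_module R M p
      by (intro local_artinian_module.intro local_artinian_module_axioms.intro
          nonvertex_artinian_module_axioms that)
    show ?thesis unfolding Let_def by (rule star_local_iff[unfolded pM_def])
  qed
  show ?thesis
  proof
    assume star: ?star
    show "?sum \<or> (\<exists>p m. local_ring_with R p \<and> ?loc p m)"
    proof (cases "\<exists>p. local_ring_with R p")
      case True
      then obtain p where p: "local_ring_with R p" by (elim exE)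
      from star have "\<exists>m. ?loc p m" unfolding local_iff[OF p] .
      then obtain m where m: "?loc p m" by (elim exE)
      show ?thesis by (rule disjI2, rule exI[of _ p], rule exI[of _ m], rule conjI[OF p m])
    next
      case False
      then show ?thesis by (intro disjI1 star_local_or_direct_sum[OF star])
    qed
  next
    assume "?sum \<or> (\<exists>p m. local_ring_with R p \<and> ?loc p m)"
    then show ?star
    proof
      assume ?sum
      then obtain M1 M2 where "direct_sum R M M1 M2"
        "simple_module R (M\<lparr>carrier := M1\<rparr>)" "simple_module R (M\<lparr>carrier := M2\<rparr>)"
        by (elim exE conjE)
      then show ?star by (rule direct_sum_star)
    next
      assume "\<exists>p m. local_ring_with R p \<and> ?loc p m"
      then obtain p m where p: "local_ring_with R p" and m: "?loc p m" by (elim exE conjE[of "local_ring_with _ _"])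
      show ?star unfolding local_iff[OF p] by (rule exI[of "?loc p" m, OF m])
    qed
  qed
qed

end
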